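(* Let $r\in(1,2)$, $0<\varepsilon_-<\varepsilon_+<\infty$, and let $\mu=\mu_\varepsilon$ be the relaxed power-law viscosity. Let $W\subset V$ be a finite-dimensional subspace, let $\mathbf{u}^\star$ be the unique minimiser of $\mathsf{E}_\varepsilon$ in $W$, let $\mathbf{u}^0\in W$, and let $\{\mathbf{u}^n\}_{n\ge0}\subset W$ be the sequence generated by the Kačanov iteration on $W$ with viscosity $\mu_\varepsilon$. Suppose that for every $n\ge 0$ the set $\{\boldsymbol{x}\in\Omega:|\underline{e}(\mathbf{u}^n(\boldsymbol{x}))|\in\{\varepsilon_-,\varepsilon_+\}\}$ has Lebesgue measure zero. Then $$0\leq\mathsf{E}_\varepsilon(\mathbf{u}^{n+1})-\mathsf{E}_\varepsilon(\mathbf{u}^\star)\leq q_A(n)\left(\mathsf{E}_\varepsilon(\mathbf{u}^n)-\mathsf{E}_\varepsilon(\mathbf{u}^\star)\right)+o_W\left(|||\mathbf{u}^\star-\mathbf{u}^n|||_\Omega^2\right),$$ where $$q_A(n):=1-\frac14\left\{\operatorname*{ess\,sup}_{\boldsymbol{x}\in\Omega}\frac{\mu_\varepsilon(|\underline{e}(\mathbf{u}^n)|^2)}{2\mu_\varepsilon'(|\underline{e}(\mathbf{u}^n)|^2)|\underline{e}(\mathbf{u}^n)|^2+\mu_\varepsilon(|\underline{e}(\mathbf{u}^n)|^2)}\right\}^{-1}$$ satisfies, independently of $\varepsilon_-$ and $\varepsilon_+$, $$q_A(n)\leq 1-\frac14(r-1)\qquad\text{for all } n\ge 0.$$ Moreover,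 $q_A(n)=1-\frac14(r-1)$ whenever the set $\{\boldsymbol{x}\in\Omega:\varepsilon_-\le|\underline{e}(\mathbf{u}^n(\boldsymbol{x}))|\le\varepsilon_+\}$ has positive Lebesgue measure. Here $o_W(|||\mathbf{u}^\star-\mathbf{u}^n|||_\Omega^2)$ denotes a remainder $\rho_n\in\mathbb{R}$, which may depend on $W$, such that for every $\epsilon>0$ there is $N$ with $|\rho_n|\le\epsilon\,|||\mathbf{u}^\star-\mathbf{u}^n|||_\Omega^2$ for all $n\ge N$.
   Context: Let $\Omega\subset\mathbb{R}^d$, $d\in\{2,3\}$, be a bounded Lipschitz domain and $\mathbf{f}\in \mathrm{L}^2(\Omega)^d$. For a vector field $\mathbf{u}$, $\underline{e}(\mathbf{u})$ is the $d\times d$ tensor with entries $e_{ij}(\mathbf{u})=\frac12\left(\frac{\partial u_i}{\partial x_j}+\frac{\partial u_j}{\partial x_i}\right)$; $|\cdot|$ denotes the Frobenius norm and $:$ the Frobenius inner product of $d\times d$ matrices. The relaxed power-law viscosity is $$\mu_\varepsilon(t):=\begin{cases}\varepsilon_-^{r-2}&\text{for }0\le t<\varepsilon_-^2,\\ t^{\frac{r-2}{2}}&\text{for }\varepsilon_-^2\le t\le\varepsilon_+^2,\\ \varepsilon_+^{r-2}&\text{for }t\ge\varepsilon_+^2;\end{cases}$$ it is differentiable on $[0,\infty)\setminus\{\varepsilon_-^2,\varepsilon_+^2\}$, with derivative $\mu_\varepsilon'$. Let $V:=\{\mathbf{u}\in \mathrm{H}^1_0(\Omega)^d:\nabla\cdot\mathbf{u}=0\}$,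 a Hilbert space with inner product $(\mathbf{u},\mathbf{v})_V=\int_\Omega\underline{e}(\mathbf{u}):\underline{e}(\mathbf{v})\,\mathrm{d}\boldsymbol{x}$ and induced norm $|||\mathbf{u}|||_\Omega=(\mathbf{u},\mathbf{u})_V^{1/2}$. The energy functional is $$\mathsf{E}_\varepsilon(\mathbf{u}):=\int_\Omega\varphi_\varepsilon(|\underline{e}(\mathbf{u})|^2)\,\mathrm{d}\boldsymbol{x}-\int_\Omega\mathbf{f}\cdot\mathbf{u}\,\mathrm{d}\boldsymbol{x},\qquad \varphi_\varepsilon(s):=\frac12\int_0^s\mu_\varepsilon(t)\,\mathrm{d}t,$$ which has a unique minimiser in $W$. Kačanov iteration on $W$: given $\mathbf{u}^0\in W$, for $n=0,1,\ldots$ let $\mathbf{u}^{n+1}\in W$ be the (unique) element with $\int_\Omega\mu_\varepsilon(|\underline{e}(\mathbf{u}^n)|^2)\underline{e}(\mathbf{u}^{n+1}):\underline{e}(\mathbf{v})\,\mathrm{d}\boldsymbol{x}=\int_\Omega\mathbf{f}\cdot\mathbf{v}\,\mathrm{d}\boldsymbol{x}$ for all $\mathbf{v}\in W$. *)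

theory Defs
  imports "HOL-Analysis.Analysis" "HOL-Probability.Essential_Supremum"
begin

text \<open>
  Elements of Lebesgue and Sobolev spaces are represented by functions on the whole space; only
  their values almost everywhere in \<open>\<Omega>\<close> matter.
\<close>

subsection \<open>Bounded Lipschitz domains\<close>

text \<open>
  Near each boundary point the domain is the strict epigraph of a Lipschitz function in the
  direction of a unit vector \<open>\<nu>\<close>; the function is defined on the hyperplane orthogonal to \<open>\<nu>\<close>,
  and \<open>x - (x \<bullet> \<nu>) *\<^sub>R \<nu>\<close> is the projection of \<open>x\<close> to it.
\<close>

definition bounded_lipschitz_domain :: "'a::euclidean_space set \<Rightarrow> bool" where
  "bounded_lipschitz_domain \<Omega> \<longleftrightarrow>
     open \<Omega> \<and> connected \<Omega> \<and> \<Omega> \<noteq> {} \<and> bounded \<Omega> \<and>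
     (\<forall>p\<in>frontier \<Omega>. \<exists>\<delta>>0. \<exists>\<nu> \<gamma> L. norm \<nu> = 1 \<and> L-lipschitz_on {y. y \<bullet> \<nu> = 0} \<gamma> \<and>
        \<Omega> \<inter> ball p \<delta> = {x \<in> ball p \<delta>. \<gamma> (x - (x \<bullet> \<nu>) *\<^sub>R \<nu>) < x \<bullet> \<nu>})"

subsection \<open>Test functions and Sobolev spaces\<close>

definition partial_deriv :: "'d::finite \<Rightarrow> (real^'d \<Rightarrow> real) \<Rightarrow> real^'d \<Rightarrow> real" where
  "partial_deriv j \<psi> x = frechet_derivative \<psi> (at x) (axis j 1)"

primrec Ck :: "nat \<Rightarrow> (real^'d::finite \<Rightarrow> real) \<Rightarrow> bool" where
  "Ck 0 \<psi> \<longleftrightarrow> continuous_on UNIV \<psi>"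
| "Ck (Suc k) \<psi> \<longleftrightarrow> (\<forall>x. \<psi> differentiable (at x)) \<and> (\<forall>j. Ck k (partial_deriv j \<psi>))"

definition test_functions :: "(real^'d::finite) set \<Rightarrow> (real^'d \<Rightarrow> real) set" where
  "test_functions \<Omega> =
     {\<psi>. (\<forall>k. Ck k \<psi>) \<and> compact (closure {x. \<psi> x \<noteq> 0}) \<and> closure {x. \<psi> x \<noteq> 0} \<subseteq> \<Omega>}"

definition L2 :: "'a::euclidean_space set \<Rightarrow> ('a \<Rightarrow> 'b::euclidean_space) set" where
  "L2 \<Omega> = {g. g \<in> borel_measurable (lebesgue_on \<Omega>) \<and>
              integrable (lebesgue_on \<Omega>) (\<lambda>x. (norm (g x))\<^sup>2)}"

definition has_weak_gradient ::
  "(real^'d::finite) set \<Rightarrow> (real^'d \<Rightarrow> real) \<Rightarrow> (real^'d \<Rightarrow> real^'d) \<Rightarrow> bool" where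
  "has_weak_gradient \<Omega> v g \<longleftrightarrow> v \<in> L2 \<Omega> \<and> g \<in> L2 \<Omega> \<and>
     (\<forall>\<psi>\<in>test_functions \<Omega>. \<forall>j.
        (LINT x|lebesgue_on \<Omega>. v x * partial_deriv j \<psi> x) =
        - (LINT x|lebesgue_on \<Omega>. g x $ j * \<psi> x))"

definition H1 :: "(real^'d::finite) set \<Rightarrow> (real^'d \<Rightarrow> real) set" where
  "H1 \<Omega> = {v. \<exists>g. has_weak_gradient \<Omega> v g}"

text \<open>Weak gradients are unique only up to null sets, so this chooses a representative.\<close>

definition weak_gradient ::
  "(real^'d::finite) set \<Rightarrow> (real^'d \<Rightarrow> real) \<Rightarrow> real^'d \<Rightarrow> real^'d" where
  "weak_gradient \<Omega> v = (SOME g. has_weak_gradient \<Omega> v g)"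

definition H1_norm :: "(real^'d::finite) set \<Rightarrow> (real^'d \<Rightarrow> real) \<Rightarrow> real" where
  "H1_norm \<Omega> v = sqrt ((LINT x|lebesgue_on \<Omega>. (v x)\<^sup>2) +
                       (LINT x|lebesgue_on \<Omega>. (norm (weak_gradient \<Omega> v x))\<^sup>2))"

definition H10 :: "(real^'d::finite) set \<Rightarrow> (real^'d \<Rightarrow> real) set" where
  "H10 \<Omega> = {v \<in> H1 \<Omega>. \<exists>\<psi>. (\<forall>k. \<psi> k \<in> test_functions \<Omega>) \<and>
                (\<lambda>k. H1_norm \<Omega> (\<lambda>x. v x - \<psi> k x)) \<longlonglongrightarrow> 0}"

subsection \<open>Vector fields\<close>

text \<open>
  On \<^typ>\<open>real^'d^'d\<close> the library's \<^const>\<open>inner\<close> and \<^const>\<open>norm\<close> are the Frobenius inner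
  product and the Frobenius norm.
\<close>

text \<open>The entry \<open>jacobian \<Omega> u x $ i $ j\<close> is the weak derivative of \<open>u\<^sub>i\<close> with respect to \<open>x\<^sub>j\<close>.\<close>

definition jacobian ::
  "(real^'d::finite) set \<Rightarrow> (real^'d \<Rightarrow> real^'d) \<Rightarrow> real^'d \<Rightarrow> real^'d^'d" where
  "jacobian \<Omega> u x = (\<chi> i. weak_gradient \<Omega> (\<lambda>y. u y $ i) x)"

definition strain ::
  "(real^'d::finite) set \<Rightarrow> (real^'d \<Rightarrow> real^'d) \<Rightarrow> real^'d \<Rightarrow> real^'d^'d" where
  "strain \<Omega> u x = (\<chi> i j. (1/2) * (jacobian \<Omega> u x $ i $ j + jacobian \<Omega> u x $ j $ i))"

definition V_space :: "(real^'d::finite) set \<Rightarrow> (real^'d \<Rightarrow> real^'d) set" where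
  "V_space \<Omega> = {u. (\<forall>i. (\<lambda>x. u x $ i) \<in> H10 \<Omega>) \<and>
                   (AE x in lebesgue_on \<Omega>. (\<Sum>i\<in>UNIV. jacobian \<Omega> u x $ i $ i) = 0)}"

definition V_inner ::
  "(real^'d::finite) set \<Rightarrow> (real^'d \<Rightarrow> real^'d) \<Rightarrow> (real^'d \<Rightarrow> real^'d) \<Rightarrow> real" where
  "V_inner \<Omega> u v = (LINT x|lebesgue_on \<Omega>. strain \<Omega> u x \<bullet> strain \<Omega> v x)"

definition V_norm :: "(real^'d::finite) set \<Rightarrow> (real^'d \<Rightarrow> real^'d) \<Rightarrow> real" where
  "V_norm \<Omega> u = sqrt (V_inner \<Omega> u u)"

text \<open>
  Since vector fields are identified when they agree almost everywhere in \<open>\<Omega>\<close>, a finite set is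
  only required to span \<open>W\<close> up to null sets; \<open>W\<close> may or may not contain all representatives of
  its elements.
\<close>

definition fin_dim_subspace_V ::
  "(real^'d::finite) set \<Rightarrow> (real^'d \<Rightarrow> real^'d) set \<Rightarrow> bool" where
  "fin_dim_subspace_V \<Omega> W \<longleftrightarrow>
     W \<subseteq> V_space \<Omega> \<and> (\<lambda>x. 0) \<in> W \<and>
     (\<forall>v\<in>W. \<forall>w\<in>W. (\<lambda>x. v x + w x) \<in> W) \<and>
     (\<forall>c. \<forall>w\<in>W. (\<lambda>x. c *\<^sub>R w x) \<in> W) \<and>
     (\<exists>B. finite B \<and> B \<subseteq> W \<and>
        (\<forall>w\<in>W. \<exists>c. AE x in lebesgue_on \<Omega>. w x = (\<Sum>b\<in>B. c b *\<^sub>R b x)))"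

subsection \<open>Viscosity, energy and iteration\<close>

text \<open>
  The first branch also covers \<open>t < 0\<close>. As \<open>mu_eps\<close> is constant near \<open>0\<close>, its two-sided derivative
  \<^const>\<open>deriv\<close> at \<open>0\<close> agrees with the one-sided derivative on \<open>[0, \<infinity>)\<close>.
\<close>

definition mu_eps :: "real \<Rightarrow> real \<Rightarrow> real \<Rightarrow> real \<Rightarrow> real" where
  "mu_eps r em ep t =
     (if t < em\<^sup>2 then em powr (r - 2)
      else if t \<le> ep\<^sup>2 then t powr ((r - 2) / 2)
      else ep powr (r - 2))"

definition phi_eps :: "real \<Rightarrow> real \<Rightarrow> real \<Rightarrow> real \<Rightarrow> real" where
  "phi_eps r em ep s = (1/2) * integral {0..s} (mu_eps r em ep)"

definition energy :: "(real^'d::finite) set \<Rightarrow> (real^'d \<Rightarrow> real^'d) \<Rightarrow>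
    real \<Rightarrow> real \<Rightarrow> real \<Rightarrow> (real^'d \<Rightarrow> real^'d) \<Rightarrow> real" where
  "energy \<Omega> f r em ep u =
     (LINT x|lebesgue_on \<Omega>. phi_eps r em ep ((norm (strain \<Omega> u x))\<^sup>2)) -
     (LINT x|lebesgue_on \<Omega>. f x \<bullet> u x)"

definition kacanov_sequence :: "(real^'d::finite) set \<Rightarrow> (real^'d \<Rightarrow> real^'d) \<Rightarrow>
    real \<Rightarrow> real \<Rightarrow> real \<Rightarrow> (real^'d \<Rightarrow> real^'d) set \<Rightarrow> (nat \<Rightarrow> real^'d \<Rightarrow> real^'d) \<Rightarrow> bool" where
  "kacanov_sequence \<Omega> f r em ep W u \<longleftrightarrow>
     u 0 \<in> W \<and>
     (\<forall>n. u (Suc n) \<in> W \<and>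
        (\<forall>v\<in>W. (LINT x|lebesgue_on \<Omega>. mu_eps r em ep ((norm (strain \<Omega> (u n) x))\<^sup>2) *
                    (strain \<Omega> (u (Suc n)) x \<bullet> strain \<Omega> v x)) =
                (LINT x|lebesgue_on \<Omega>. f x \<bullet> v x)))"

text \<open>
  For \<open>1 < r < 2\<close> the quotient takes only the values \<open>1\<close> and \<open>1 / (r - 1)\<close> away from the kinks
  \<open>em\<^sup>2\<close> and \<open>ep\<^sup>2\<close> of \<open>mu_eps\<close>, where \<^const>\<open>deriv\<close> is unspecified. If the strain norm of \<open>w\<close>
  meets \<open>{em, ep}\<close> only on a null set, the essential supremum is thus finite and nonzero.
\<close>

definition q_A ::
  "(real^'d::finite) set \<Rightarrow> real \<Rightarrow> real \<Rightarrow> real \<Rightarrow> (real^'d \<Rightarrow> real^'d) \<Rightarrow> real" where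
  "q_A \<Omega> r em ep w = 1 - (1/4) * inverse (real_of_ereal
     (esssup (lebesgue_on \<Omega>) (\<lambda>x. let t = (norm (strain \<Omega> w x))\<^sup>2 in
        ereal (mu_eps r em ep t / (2 * deriv (mu_eps r em ep) t * t + mu_eps r em ep t)))))"

end

theory Submission
  imports Defs
begin

text \<open>
  Write \<open>q\<close>, \<open>p\<close> for the strains of \<open>u\<^sup>n\<close>, \<open>u\<^sup>*\<close>, and \<open>D\<close>, \<open>\<delta>\<close> for those of \<open>u\<^sup>n\<^sup>+\<^sup>1 - u\<^sup>n\<close>,
  \<open>u\<^sup>* - u\<^sup>n\<close>. Since \<open>\<mu>\<close> is nonincreasing, one step lowers the energy by at least \<open>1/2 \<integral> \<mu> |D|\<^sup>2\<close>,
  while the iteration equation gives \<open>E(u\<^sup>n) - E(u\<^sup>*) = \<integral> \<mu> D : \<delta> - \<integral> B(q, p)\<close> exactly, where \<open>B\<close> is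
  the Bregman distance of \<open>\<phi>(|\<cdot>|\<^sup>2)\<close>. If \<open>B(q, p) \<ge> \<kappa>/8 \<mu> |\<delta>|\<^sup>2\<close> pointwise, with \<open>1/\<kappa>\<close> the essential
  supremum in \<open>q_A\<close>, then completing the square gives contraction with factor \<open>1 - \<kappa>/4\<close> and no
  remainder.

  This bound holds for \<open>q\<close> close to \<open>p\<close>, depending on \<open>p\<close>: for \<open>\<kappa> = r - 1\<close> because the stress is strongly
  monotone with constant \<open>(r - 1) \<mu>\<close>, and for \<open>\<kappa> = 1\<close> because then \<open>|q|\<close> avoids the nonconstant range of
  \<open>\<mu>\<close>, so that \<open>B\<close> is exactly quadratic.
  On the finite-dimensional \<open>W\<close> strains satisfy \<open>|\<delta>|\<^sup>2 \<le> |||\<delta>|||\<^sup>2 G\<close> almost everywhere with a fixed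
  integrable \<open>G\<close>; hence \<open>q\<close> tends to \<open>p\<close> almost everywhere, and by dominated convergence the part of the
  integrals over the points where the bound still fails is \<open>o(|||\<delta>|||\<^sup>2)\<close>.

  The force enters only through the iteration equation, which expresses it by strains, so Korn's
  inequality is not used.
\<close>

subsection \<open>The fundamental lemma of the calculus of variations\<close>

text \<open>The positive and negative parts of a Borel version \<open>h\<close> of \<open>H\<close>
  are densities of two measures. These agree on open boxes, an intersection-stable generator of the
  Borel sets, hence everywhere, and densities with finite integral are unique almost
  everywhere.\<close>

lemma AE_lebesgue_zero_if_box_integrals_zero:
  fixes H :: "'a::euclidean_space \<Rightarrow> real"
  assumes int: "integrable lebesgue H"
    and zero: "\<And>a b. (LINT x|lebesgue. indicator (box a b) x * H x) = 0"
  shows "AE x in lebesgue. H x = 0"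
proof -
  obtain h where h [measurable]: "h \<in> borel_measurable lborel" and Hh: "AE x in lborel. H x = h x"
    using completion_ex_borel_measurable_real[of H lborel] int by auto
  have Hh': "AE x in lebesgue. H x = h x"
    using Hh by (simp add: AE_completion_iff)
  have [measurable]: "H \<in> borel_measurable lebesgue" using int by auto
  have hc [measurable]: "h \<in> borel_measurable lebesgue"
    using h by (simp add: measurable_completion)
  have ih: "integrable lborel h"
  proof -
    have "integrable lebesgue h"
      by (rule integrable_cong_AE_imp[OF int hc Hh'])
    then show ?thesis by (simp add: integrable_completion)
  qed
  have zh: "(LINT x|lborel. indicator (box a b) x * h x) = 0" for a b
  proof -
    have [measurable]: "box a b \<in> sets lebesgue" by simp
    have "(LINT x|lborel. indicator (box a b) x * h x) = (LINT x|lebesgue. indicator (box a b) x * h x)"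
      by (rule integral_completion[symmetric]) simp
    also have "\<dots> = (LINT x|lebesgue. indicator (box a b) x * H x)"
      using Hh' by (intro integral_cong_AE) auto
    finally show ?thesis using zero by simp
  qed
  let ?p = "\<lambda>x. ennreal (h x)" and ?n = "\<lambda>x. ennreal (- h x)"
  have em: "emeasure (density lborel (\<lambda>x. ennreal (g x))) (box a b)
      = ennreal (LINT x|lborel. indicator (box a b) x * max 0 (g x))"
    if g [measurable]: "g \<in> borel_measurable lborel" and "integrable lborel g" for g :: "'a \<Rightarrow> real" and a b
  proof -
    have "emeasure (density lborel (\<lambda>x. ennreal (g x))) (box a b)
        = (\<integral>\<^sup>+x. ennreal (indicator (box a b) x * max 0 (g x)) \<partial>lborel)"
      by (subst emeasure_density) (auto intro!: nn_integral_cong simp: indicator_def max_def ennreal_neg)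
    also have "\<dots> = ennreal (LINT x|lborel. indicator (box a b) x * max 0 (g x))"
      using that by (intro nn_integral_eq_integral integrable_mult_indicator[where 'b=real, simplified real_scaleR_def]) auto
    finally show ?thesis .
  qed
  have "density lborel ?p = density lborel ?n"
  proof (rule measure_eqI_generator_eq)
    show "Int_stable (range (\<lambda>(a, b). box a b :: 'a set))"
      by (auto simp: Int_stable_def box_Int_box)
    show "range (\<lambda>(a, b). box a b :: 'a set) \<subseteq> Pow UNIV" by simp
    show "sets (density lborel ?p) = sigma_sets UNIV (range (\<lambda>(a, b). box a b))"
      "sets (density lborel ?n) = sigma_sets UNIV (range (\<lambda>(a, b). box a b))"
      by (simp_all add: borel_eq_box)
    show "range (\<lambda>i::nat. box (- (real i *\<^sub>R One)) (real i *\<^sub>R One) :: 'a set) \<subseteq> range (\<lambda>(a, b). box a b)"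
      by auto
    show "(\<Union>i::nat. box (- (real i *\<^sub>R One)) (real i *\<^sub>R One)) = (UNIV :: 'a set)"
      by (rule UN_box_eq_UNIV)
    show "emeasure (density lborel ?p) (box (- (real i *\<^sub>R One)) (real i *\<^sub>R One)) \<noteq> \<infinity>" for i
      using ih by (subst em) auto
    fix X :: "'a set" assume "X \<in> range (\<lambda>(a, b). box a b)"
    then obtain a b where X: "X = box a b" by auto
    have "(LINT x|lborel. indicator X x * max 0 (h x)) - (LINT x|lborel. indicator X x * max 0 (- h x))
        = (LINT x|lborel. indicator X x * max 0 (h x) - indicator X x * max 0 (- h x))"
      unfolding X using ih
      by (intro Bochner_Integration.integral_diff[symmetric]
          integrable_mult_indicator[where 'b=real, simplified real_scaleR_def]) auto
    also have "\<dots> = (LINT x|lborel. indicator X x * h x)"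
      by (intro Bochner_Integration.integral_cong) (auto simp: indicator_def max_def)
    finally have "(LINT x|lborel. indicator X x * max 0 (h x)) = (LINT x|lborel. indicator X x * max 0 (- h x))"
      using zh X by simp
    then show "emeasure (density lborel ?p) X = emeasure (density lborel ?n) X"
      unfolding X using ih by (subst (1 2) em) auto
  qed
  moreover have "(\<integral>\<^sup>+x. ?p x \<partial>lborel) \<noteq> \<infinity>"
  proof -
    have "(\<integral>\<^sup>+x. ?p x \<partial>lborel) \<le> (\<integral>\<^sup>+x. ennreal (norm (h x)) \<partial>lborel)"
      by (intro nn_integral_mono) (auto intro: ennreal_leI)
    also have "\<dots> < \<infinity>" using ih by (simp add: integrable_iff_bounded)
    finally show ?thesis by simp
  qed
  ultimately have "AE x in lborel. ?p x = ?n x"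
    by (subst (asm) finite_density_unique) auto
  \<comment> \<open>\<open>ennreal\<close> sends negative numbers to 0, so at each point at least
    one side is 0; equality makes both vanish.\<close>
  then have "AE x in lborel. h x = 0"
  proof eventually_elim
    case (elim x)
    then show ?case
      by (cases "0 \<le> h x") (auto simp: ennreal_neg ennreal_eq_0_iff dest: sym)
  qed
  then have "AE x in lebesgue. h x = 0" by (simp add: AE_completion_iff)
  with Hh' show ?thesis by eventually_elim simp
qed

text \<open>
  Derivatives of \<open>\<lambda>t. exp (- 1 / t)\<close> have the form \<open>\<lambda>t. poly P (1 / t) * exp (- 1 / t)\<close>.
\<close>

definition flat :: "real poly \<Rightarrow> real \<Rightarrow> real" where
  "flat P t = (if t \<le> 0 then 0 else poly P (1 / t) * exp (- (1 / t)))"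

text \<open>Chain rule with \<open>y = 1 / t\<close>: the derivative of \<open>P(y) exp(-y)\<close>
  in \<open>t\<close> is \<open>y^2 (P(y) - P'(y)) exp(-y)\<close>.\<close>

definition flat_deriv :: "real poly \<Rightarrow> real poly" where
  "flat_deriv P = [:0, 0, 1:] * (P - pderiv P)"

lemma poly_mult_exp_tendsto_0: "((\<lambda>y. poly P y * exp (- y)) \<longlongrightarrow> (0::real)) at_top"
proof -
  have "((\<lambda>y. \<Sum>i\<le>degree P. coeff P i * (y ^ i / exp y)) \<longlongrightarrow> (\<Sum>i\<le>degree P. coeff P i * 0)) at_top"
    by (intro tendsto_intros tendsto_power_div_exp_0)
  then show ?thesis
    by (simp add: poly_altdef sum_distrib_right sum_divide_distrib exp_minus field_simps)
qed

lemma flat_has_derivative: "(flat P has_real_derivative flat (flat_deriv P) t) (at t)"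
proof -
  consider "t < 0" | "t = 0" | "0 < t" by linarith
  then show ?thesis
  proof cases
    case 1
    have "((\<lambda>_. 0) has_real_derivative 0) (at t)" by simp
    then have "(flat P has_real_derivative 0) (at t)"
      by (rule has_field_derivative_transform_within_open[where S = "{..<0}"])
        (use 1 in \<open>auto simp: flat_def\<close>)
    then show ?thesis using 1 by (simp add: flat_def)
  next
    case 3
    have "((\<lambda>t. poly P (1 / t) * exp (- (1 / t))) has_real_derivative
        poly (pderiv P) (1 / t) * (- (1 / t\<^sup>2)) * exp (- (1 / t))
        + exp (- (1 / t)) * (1 / t\<^sup>2) * poly P (1 / t)) (at t)"
      using 3 by (auto intro!: derivative_eq_intros DERIV_chain2[OF poly_DERIV] simp: power2_eq_square)
    also have "poly (pderiv P) (1 / t) * (- (1 / t\<^sup>2)) * exp (- (1 / t))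
        + exp (- (1 / t)) * (1 / t\<^sup>2) * poly P (1 / t) = flat (flat_deriv P) t"
      using 3 by (simp add: flat_def flat_deriv_def algebra_simps power2_eq_square)
    finally show ?thesis
      by (rule has_field_derivative_transform_within_open[where S = "{0<..}"])
        (use 3 in \<open>auto simp: flat_def\<close>)
  next
    case 2
    have "((\<lambda>h. flat P h / h) \<longlongrightarrow> 0) (at_right 0)"
    proof -
      \<comment> \<open>Dividing by \<open>h\<close> multiplies the polynomial by
        \<open>y = 1 / h\<close>, which is the effect of \<open>pCons 0\<close>; the exponential
        still wins.\<close>
      have "((\<lambda>h. poly (pCons 0 P) (inverse h) * exp (- (inverse h))) \<longlongrightarrow> 0) (at_right 0)"
        by (rule filterlim_compose[OF poly_mult_exp_tendsto_0 filterlim_inverse_at_top_right])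
      then show ?thesis
        by (rule Lim_transform_eventually)
          (auto simp: eventually_at_filter flat_def field_simps)
    qed
    moreover have "((\<lambda>h. flat P h / h) \<longlongrightarrow> 0) (at_left 0)"
      by (rule Lim_transform_eventually[OF tendsto_const]) (auto simp: eventually_at_filter flat_def)
    ultimately have "((\<lambda>h. flat P h / h) \<longlongrightarrow> 0) (at 0)"
      by (simp add: filterlim_split_at)
    then show ?thesis
      using 2 by (simp add: DERIV_def flat_def)
  qed
qed

section \<open>Smooth bump functions supported in boxes\<close>

lemma partial_derivI: "(f has_derivative f') (at x) \<Longrightarrow> partial_deriv j f x = f' (axis j 1)"
  using frechet_derivative_at[of f f' x] by (simp add: partial_deriv_def)

lemma Ck_sum:
  "finite I \<Longrightarrow> (\<And>i. i \<in> I \<Longrightarrow> Ck k (f i)) \<Longrightarrow> Ck k (\<lambda>x. \<Sum>i\<in>I. c i * f i x)"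
proof (induction k arbitrary: f)
  case 0
  then show ?case by (auto intro!: continuous_intros)
next
  case (Suc k)
  have d: "(f i has_derivative frechet_derivative (f i) (at x)) (at x)" if "i \<in> I" for i x
    using Suc.prems(2)[OF that] by (simp add: frechet_derivative_works)
  have D: "((\<lambda>x. \<Sum>i\<in>I. c i * f i x) has_derivative
      (\<lambda>h. \<Sum>i\<in>I. c i * frechet_derivative (f i) (at x) h)) (at x)" for x
    by (intro has_derivative_sum has_derivative_mult_right d)
  have "partial_deriv j (\<lambda>x. \<Sum>i\<in>I. c i * f i x) = (\<lambda>x. \<Sum>i\<in>I. c i * partial_deriv j (f i) x)" for j
    using partial_derivI[OF D] by (auto simp: partial_deriv_def)
  moreover have "Ck k (\<lambda>x. \<Sum>i\<in>I. c i * partial_deriv j (f i) x)" for j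
    using Suc.prems by (intro Suc.IH) auto
  ultimately show ?case using D by (auto simp: differentiable_def)
qed

text \<open>Differentiation stays in this family: by the product rule a partial derivative is a
  linear combination of such products with one \<open>P i\<close> replaced by its
  \<open>flat_deriv\<close>. The induction therefore treats all \<open>P\<close> at once. The map
  \<open>idx\<close> lets several factors depend on the same coordinate.\<close>

lemma Ck_flat_prod:
  fixes \<alpha> \<beta> :: "'i \<Rightarrow> real" and idx :: "'i \<Rightarrow> 'd::finite"
  assumes I: "finite I"
  shows "Ck k (\<lambda>x. \<Prod>i\<in>I. flat (P i) (\<alpha> i * x $ idx i + \<beta> i))"
proof (induction k arbitrary: P)
  case 0
  have "continuous_on UNIV (flat Q)" for Q
    by (meson DERIV_isCont continuous_at_imp_continuous_on flat_has_derivative)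
  then have "continuous_on UNIV (\<lambda>x :: real^'d. flat (P i) (\<alpha> i * x $ idx i + \<beta> i))" for i
    by (rule continuous_on_compose2) (auto intro!: continuous_intros)
  then show ?case by (auto intro: continuous_on_prod)
next
  case (Suc k)
  let ?L = "\<lambda>i (x :: real^'d). \<alpha> i * x $ idx i + \<beta> i"
  let ?T = "\<lambda>P x. \<Prod>i\<in>I. flat (P i) (?L i x)"
  have d: "((\<lambda>x. flat (P i) (?L i x)) has_derivative
      (\<lambda>h. flat (flat_deriv (P i)) (?L i x) * (\<alpha> i * h $ idx i))) (at x)" for i x
  proof -
    have "(?L i has_derivative (\<lambda>h. \<alpha> i * h $ idx i)) (at x)"
      by (auto intro!: derivative_eq_intros bounded_linear.has_derivative[OF bounded_linear_vec_nth])
    from has_derivative_compose[OF this flat_has_derivative[unfolded has_field_derivative_def]]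
    show ?thesis .
  qed
  have D: "(?T P has_derivative (\<lambda>h. \<Sum>i\<in>I. flat (flat_deriv (P i)) (?L i x) * (\<alpha> i * h $ idx i) *
      (\<Prod>j\<in>I - {i}. flat (P j) (?L j x)))) (at x)" for x
    by (intro has_derivative_prod d)
  have "partial_deriv j (?T P)
      = (\<lambda>x. \<Sum>i\<in>I. (\<alpha> i * axis j 1 $ idx i) * ?T (P(i := flat_deriv (P i))) x)" for j
  proof
    fix x
    have "?T (P(i := flat_deriv (P i))) x
        = flat (flat_deriv (P i)) (?L i x) * (\<Prod>j\<in>I - {i}. flat (P j) (?L j x))" if "i \<in> I" for i
      using I that by (subst prod.remove[of I i]) (auto intro!: prod.cong)
    then show "partial_deriv j (?T P) x
        = (\<Sum>i\<in>I. (\<alpha> i * axis j 1 $ idx i) * ?T (P(i := flat_deriv (P i))) x)"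
      unfolding partial_derivI[OF D] by (intro sum.cong) auto
  qed
  moreover have "Ck k (\<lambda>x. \<Sum>i\<in>I. (\<alpha> i * axis j 1 $ idx i) * ?T (P(i := flat_deriv (P i))) x)" for j
    using I Suc.IH by (intro Ck_sum) auto
  ultimately show ?case using D by (auto simp: differentiable_def)
qed

text \<open>Smooth approximations, as \<open>m\<close> grows, of the indicator of
  \<open>box a b\<close>, with one factor for each face. The shift by 1 keeps the support at
  distance \<open>1 / m\<close> inside the faces, hence compact in the open box. The arguments are
  written in the affine form that \<open>Ck_flat_prod\<close> expects.\<close>

definition box_bump :: "real^'d::finite \<Rightarrow> real^'d \<Rightarrow> nat \<Rightarrow> real^'d \<Rightarrow> real" where
  "box_bump a b m x = (\<Prod>i\<in>UNIV. flat 1 (real m * x $ i + (- real m * a $ i - 1))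
      * flat 1 (- real m * x $ i + (real m * b $ i - 1)))"

lemma flat_1_bounds: "0 \<le> flat 1 t" "flat 1 t \<le> 1"
  by (auto simp: flat_def)

lemma flat_1_tendsto: "0 < d \<Longrightarrow> (\<lambda>m. flat 1 (real m * d - 1)) \<longlonglongrightarrow> 1"
proof -
  assume d: "0 < d"
  have at: "filterlim (\<lambda>m. real m * d - 1) at_top sequentially"
    using d by real_asymp
  have "(\<lambda>m. exp (- (1 / (real m * d - 1)))) \<longlonglongrightarrow> exp (- 0)"
    by (intro tendsto_intros real_tendsto_divide_at_top[OF tendsto_const] at)
  moreover have "\<forall>\<^sub>F m in sequentially. 0 < real m * d - 1"
    using at by (rule filterlim_at_top_dense[THEN iffD1, rule_format])
  then have "\<forall>\<^sub>F m in sequentially. exp (- (1 / (real m * d - 1))) = flat 1 (real m * d - 1)"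
    by eventually_elim (simp add: flat_def)
  ultimately show ?thesis by (simp add: Lim_transform_eventually)
qed

lemma box_bump_bounds: "0 \<le> box_bump a b m x" "box_bump a b m x \<le> 1"
  unfolding box_bump_def
  by (auto intro!: prod_nonneg prod_le_1 mult_nonneg_nonneg mult_le_one flat_1_bounds)

lemma box_bump_tendsto: "(\<lambda>m. box_bump a b m x) \<longlonglongrightarrow> indicator (box a b) x"
proof (cases "x \<in> box a b")
  case True
  then have "(\<lambda>m. flat 1 (real m * (x $ i - a $ i) - 1) * flat 1 (real m * (b $ i - x $ i) - 1)) \<longlonglongrightarrow> 1 * 1" for i
    by (intro tendsto_mult flat_1_tendsto) (auto simp: mem_box_cart)
  then have "(\<lambda>m. \<Prod>i\<in>UNIV. flat 1 (real m * (x $ i - a $ i) - 1) * flat 1 (real m * (b $ i - x $ i) - 1))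
      \<longlonglongrightarrow> (\<Prod>i\<in>(UNIV :: 'a set). 1)"
    by (intro tendsto_prod) auto
  moreover have "box_bump a b m x = (\<Prod>i\<in>UNIV. flat 1 (real m * (x $ i - a $ i) - 1) * flat 1 (real m * (b $ i - x $ i) - 1))" for m
    unfolding box_bump_def by (simp add: algebra_simps)
  ultimately show ?thesis using True by simp
next
  case False
  then obtain i where i: "x $ i \<le> a $ i \<or> b $ i \<le> x $ i" by (auto simp: mem_box_cart not_less)
  have "box_bump a b m x = 0" for m
  proof -
    have "real m * x $ i + (- real m * a $ i - 1) \<le> 0 \<or> - real m * x $ i + (real m * b $ i - 1) \<le> 0"
      using i mult_left_mono[of "x $ i" "a $ i" "real m"] mult_left_mono[of "b $ i" "x $ i" "real m"] by auto
    then show ?thesis unfolding box_bump_def by (intro prod_zero) (auto simp: flat_def)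
  qed
  then show ?thesis using False by simp
qed

lemma box_bump_test_function:
  assumes "box a b \<subseteq> \<Omega>"
  shows "box_bump a b m \<in> test_functions \<Omega>"
proof -
  let ?K = "{x. \<forall>i. real m * a $ i + 1 \<le> real m * x $ i \<and> real m * x $ i \<le> real m * b $ i - 1}"
  \<comment> \<open>The factors are indexed by a coordinate and a Boolean that selects the lower or
    the upper face.\<close>
  have "Ck k (\<lambda>x. \<Prod>(i,s)\<in>UNIV. flat 1 ((if s then real m else - real m) * x $ i +
      (if s then - real m * a $ i - 1 else real m * b $ i - 1)))" for k
    using Ck_flat_prod[of "UNIV :: ('a \<times> bool) set" k "\<lambda>_. 1" "\<lambda>(i,s). if s then real m else - real m"
       fst "\<lambda>(i,s). if s then - real m * a $ i - 1 else real m * b $ i - 1"]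
    by (simp add: case_prod_unfold)
  moreover have "(\<lambda>x. \<Prod>(i,s)\<in>UNIV. flat 1 ((if s then real m else - real m) * x $ i +
      (if s then - real m * a $ i - 1 else real m * b $ i - 1))) = box_bump a b m"
    unfolding box_bump_def UNIV_Times_UNIV[symmetric] prod.cartesian_product[symmetric]
    by (simp add: UNIV_bool mult.commute)
  ultimately have "Ck k (box_bump a b m)" for k by simp
  moreover have sub: "{x. box_bump a b m x \<noteq> 0} \<subseteq> ?K"
  proof clarify
    fix x i assume "box_bump a b m x \<noteq> 0"
    then have "flat 1 (real m * x $ i + (- real m * a $ i - 1)) \<noteq> 0"
      "flat 1 (- real m * x $ i + (real m * b $ i - 1)) \<noteq> 0"
      by (auto simp: box_bump_def)
    then show "real m * a $ i + 1 \<le> real m * x $ i \<and> real m * x $ i \<le> real m * b $ i - 1"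
      by (auto simp: flat_def split: if_splits)
  qed
  moreover have "closed ?K"
    by (intro closed_Collect_all closed_Collect_conj closed_Collect_le continuous_intros)
  moreover have K: "?K \<subseteq> box a b"
  proof
    fix x assume x: "x \<in> ?K"
    \<comment> \<open>For \<open>m = 0\<close> the conditions defining \<open>?K\<close> demand
      \<open>1 \<le> 0\<close>, so \<open>?K\<close> is empty.\<close>
    have "0 < m"
    proof (rule ccontr)
      assume "\<not> 0 < m" then show False using x by auto
    qed
    have "a $ i < x $ i \<and> x $ i < b $ i" for i
    proof -
      have "real m * a $ i < real m * x $ i" "real m * x $ i < real m * b $ i"
        using x by (auto simp: add.commute dest: spec[of _ i])
      then show ?thesis using \<open>0 < m\<close> by simp
    qed
    then show "x \<in> box a b" by (simp add: mem_box_cart)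
  qed
  ultimately have cl: "closure {x. box_bump a b m x \<noteq> 0} \<subseteq> box a b"
    by (meson closure_minimal order_trans)
  moreover have "bounded (closure {x. box_bump a b m x \<noteq> 0})"
    using cl bounded_box bounded_subset by blast
  ultimately show ?thesis
    unfolding test_functions_def using assms \<open>\<And>k. Ck k (box_bump a b m)\<close>
    by (auto simp: compact_eq_bounded_closed)
qed

lemma test_function_continuous: "\<psi> \<in> test_functions \<Omega> \<Longrightarrow> continuous_on S \<psi>"
  unfolding test_functions_def mem_Collect_eq
  by (metis Ck.simps(1) continuous_on_subset subset_UNIV)

lemma test_function_partial_deriv_continuous:
  "\<psi> \<in> test_functions \<Omega> \<Longrightarrow> continuous_on S (partial_deriv j \<psi>)"
  unfolding test_functions_def mem_Collect_eq
  by (metis Ck.simps continuous_on_subset subset_UNIV)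

text \<open>Testing with bumps and passing to the limit, with \<open>\<bar>h\<bar>\<close> as
  dominating function, shows that \<open>h\<close> has integral zero over every box inside the
  domain. The domain is a countable union of open boxes, so it suffices to treat \<open>h\<close> on
  each of them.\<close>

lemma du_Bois_Reymond:
  fixes \<Omega> :: "(real^'d::finite) set"
  assumes \<Omega>: "open \<Omega>" and h: "integrable (lebesgue_on \<Omega>) h"
    and zero: "\<And>\<psi>. \<psi> \<in> test_functions \<Omega> \<Longrightarrow> (LINT x|lebesgue_on \<Omega>. h x * \<psi> x) = 0"
  shows "AE x in lebesgue_on \<Omega>. h x = 0"
proof -
  have \<Omega>m [measurable]: "\<Omega> \<in> sets lebesgue" using \<Omega> by (simp add: borel_open)
  have ih: "integrable lebesgue (\<lambda>x. indicator \<Omega> x * h x)"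
    using h by (simp add: integrable_restrict_space)
  have int_box: "(LINT x|lebesgue. indicator (box a b) x * (indicator \<Omega> x * h x)) = 0" if "box a b \<subseteq> \<Omega>" for a b
  proof -
    have "(\<lambda>m. LINT x|lebesgue_on \<Omega>. h x * box_bump a b m x)
      \<longlonglongrightarrow> (LINT x|lebesgue_on \<Omega>. h x * indicator (box a b) x)"
    proof (rule integral_dominated_convergence[where w = "\<lambda>x. norm (h x)"])
      have [measurable]: "box_bump a b m \<in> borel_measurable (lebesgue_on \<Omega>)" for m
        using test_function_continuous[OF box_bump_test_function[OF that], of \<Omega> m]
        by (intro continuous_imp_measurable_on_sets_lebesgue) auto
      have [measurable]: "box a b \<in> sets (lebesgue_on \<Omega>)"
        using that by (simp add: sets_restrict_space_iff)
      note [measurable] = borel_measurable_integrable[OF h]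
      show "(\<lambda>x. h x * indicator (box a b) x) \<in> borel_measurable (lebesgue_on \<Omega>)" by measurable
      show "(\<lambda>x. h x * box_bump a b m x) \<in> borel_measurable (lebesgue_on \<Omega>)" for m by measurable
      show "integrable (lebesgue_on \<Omega>) (\<lambda>x. norm (h x))" using h by simp
      show "AE x in lebesgue_on \<Omega>. (\<lambda>m. h x * box_bump a b m x) \<longlonglongrightarrow> h x * indicator (box a b) x"
        by (intro AE_I2 tendsto_intros box_bump_tendsto)
      show "AE x in lebesgue_on \<Omega>. norm (h x * box_bump a b m x) \<le> norm (h x)" for m
        using box_bump_bounds[of a b m] by (intro AE_I2) (auto simp: abs_mult intro!: mult_left_le)
    qed
    moreover have "(LINT x|lebesgue_on \<Omega>. h x * box_bump a b m x) = 0" for m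
      using box_bump_test_function[OF that] by (rule zero)
    ultimately have "(LINT x|lebesgue_on \<Omega>. h x * indicator (box a b) x) = 0"
      by (simp add: LIMSEQ_const_iff)
    then show ?thesis by (simp add: integral_restrict_space mult_ac)
  qed
  obtain \<D> where D: "countable \<D>" "\<D> \<subseteq> Pow \<Omega>" "\<And>X. X \<in> \<D> \<Longrightarrow> \<exists>a b. X = box a b" "\<Union>\<D> = \<Omega>"
    using open_countable_Union_open_box[OF \<Omega>] by metis
  have "AE x in lebesgue. x \<in> X \<longrightarrow> h x = 0" if X: "X \<in> \<D>" for X
  proof -
    obtain l u where lu: "X = box l u" using D(3)[OF X] by auto
    have X\<Omega>: "X \<subseteq> \<Omega>" using D(2) X by auto
    have "AE x in lebesgue. indicator X x * (indicator \<Omega> x * h x) = 0"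
    proof (rule AE_lebesgue_zero_if_box_integrals_zero)
      show "integrable lebesgue (\<lambda>x. indicator X x * (indicator \<Omega> x * h x))"
        using integrable_mult_indicator[OF _ ih, of X] lu by simp
      fix a b
      \<comment> \<open>An arbitrary box may leave the domain, but its intersection with
        \<open>X\<close> is again a box and lies inside.\<close>
      obtain c d where cd: "box a b \<inter> X = box c d" unfolding lu box_Int_box by blast
      have "(LINT x|lebesgue. indicator (box a b) x * (indicator X x * (indicator \<Omega> x * h x)))
          = (LINT x|lebesgue. indicator (box c d) x * (indicator \<Omega> x * h x))"
        unfolding cd[symmetric] by (simp add: indicator_inter_arith mult.assoc)
      also have "\<dots> = 0" using cd X\<Omega> by (intro int_box) blast
      finally show "(LINT x|lebesgue. indicator (box a b) x * (indicator X x * (indicator \<Omega> x * h x))) = 0" .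
    qed
    then show ?thesis
    proof eventually_elim
      case (elim x)
      then show ?case using X\<Omega> by (auto simp: indicator_def split: if_splits)
    qed
  qed
  then have "AE x in lebesgue. \<forall>X\<in>\<D>. x \<in> X \<longrightarrow> h x = 0"
    using AE_ball_countable[OF D(1), where M = lebesgue and P = "\<lambda>x X. x \<in> X \<longrightarrow> h x = 0"] by blast
  then have "AE x in lebesgue. x \<in> \<Omega> \<longrightarrow> h x = 0"
    by eventually_elim (use D(4) in blast)
  then show ?thesis by (simp add: AE_restrict_space_iff)
qed

subsection \<open>Square-integrable functions and weak gradients\<close>

lemma L2_measurable [measurable_dest]: "g \<in> L2 \<Omega> \<Longrightarrow> g \<in> borel_measurable (lebesgue_on \<Omega>)"
  by (simp add: L2_def)

lemma L2_integrable_norm_square: "g \<in> L2 \<Omega> \<Longrightarrow> integrable (lebesgue_on \<Omega>) (\<lambda>x. (norm (g x))\<^sup>2)"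
  by (simp add: L2_def)

lemma L2_I_bound:
  assumes "g \<in> borel_measurable (lebesgue_on \<Omega>)" "integrable (lebesgue_on \<Omega>) b"
    and "AE x in lebesgue_on \<Omega>. (norm (g x))\<^sup>2 \<le> b x"
  shows "g \<in> L2 \<Omega>"
proof -
  have "integrable (lebesgue_on \<Omega>) (\<lambda>x. (norm (g x))\<^sup>2)"
    using assms(2) by (rule Bochner_Integration.integrable_bound) (use assms in \<open>auto elim: eventually_mono\<close>)
  then show ?thesis using assms(1) by (simp add: L2_def)
qed

lemma norm_add_square_le: "(norm (x + y))\<^sup>2 \<le> 2 * (norm x)\<^sup>2 + 2 * (norm y)\<^sup>2"
  for x y :: "'a::real_normed_vector"
proof -
  have "(norm (x + y))\<^sup>2 \<le> (norm x + norm y)\<^sup>2"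
    by (intro power_mono norm_triangle_ineq) simp
  also have "\<dots> \<le> 2 * (norm x)\<^sup>2 + 2 * (norm y)\<^sup>2"
    using sum_squares_bound[of "norm x" "norm y"] by (simp add: power2_sum)
  finally show ?thesis .
qed

lemma L2_add: "f \<in> L2 \<Omega> \<Longrightarrow> g \<in> L2 \<Omega> \<Longrightarrow> (\<lambda>x. f x + g x) \<in> L2 \<Omega>"
  by (rule L2_I_bound[where b = "\<lambda>x. 2 * (norm (f x))\<^sup>2 + 2 * (norm (g x))\<^sup>2"])
     (auto simp: L2_def norm_add_square_le)

lemma L2_scaleR: "g \<in> L2 \<Omega> \<Longrightarrow> (\<lambda>x. c *\<^sub>R g x) \<in> L2 \<Omega>"
  by (auto simp: L2_def power_mult_distrib)

lemma L2_diff: "f \<in> L2 \<Omega> \<Longrightarrow> g \<in> L2 \<Omega> \<Longrightarrow> (\<lambda>x. f x - g x) \<in> L2 \<Omega>"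
  using L2_add[of f \<Omega> "\<lambda>x. - 1 *\<^sub>R g x"] L2_scaleR[of g \<Omega> "- 1"] by simp

lemma L2_zero: "(\<lambda>x. 0) \<in> L2 \<Omega>"
  by (simp add: L2_def)

lemma L2_sum: "finite I \<Longrightarrow> (\<And>i. i \<in> I \<Longrightarrow> f i \<in> L2 \<Omega>) \<Longrightarrow> (\<lambda>x. \<Sum>i\<in>I. c i *\<^sub>R f i x) \<in> L2 \<Omega>"
  by (induction I rule: finite_induct) (auto intro!: L2_add L2_scaleR L2_zero)

lemma integrable_weighted_inner:
  assumes "f \<in> L2 \<Omega>" "g \<in> L2 \<Omega>" and [measurable]: "w \<in> borel_measurable (lebesgue_on \<Omega>)"
    and w: "\<And>x. \<bar>w x\<bar> \<le> C"
  shows "integrable (lebesgue_on \<Omega>) (\<lambda>x. w x * (f x \<bullet> g x))"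
proof (rule Bochner_Integration.integrable_bound)
  note [measurable] = assms(1,2)[THEN L2_measurable]
  show "(\<lambda>x. w x * (f x \<bullet> g x)) \<in> borel_measurable (lebesgue_on \<Omega>)" by measurable
  show "integrable (lebesgue_on \<Omega>) (\<lambda>x. C * ((norm (f x))\<^sup>2 + (norm (g x))\<^sup>2))"
    using assms(1,2) by (auto intro: L2_integrable_norm_square)
  have C: "0 \<le> C" using w[of undefined] by linarith
  have "\<bar>f x \<bullet> g x\<bar> \<le> (norm (f x))\<^sup>2 + (norm (g x))\<^sup>2" for x
    using Cauchy_Schwarz_ineq2[of "f x" "g x"] sum_squares_bound[of "norm (f x)" "norm (g x)"]
      mult_nonneg_nonneg[OF norm_ge_zero[of "f x"] norm_ge_zero[of "g x"]] by linarith
  then have "\<bar>w x\<bar> * \<bar>f x \<bullet> g x\<bar> \<le> C * ((norm (f x))\<^sup>2 + (norm (g x))\<^sup>2)" for x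
    using w C by (intro mult_mono) auto
  then show "AE x in lebesgue_on \<Omega>. norm (w x * (f x \<bullet> g x)) \<le> norm (C * ((norm (f x))\<^sup>2 + (norm (g x))\<^sup>2))"
    using C by (simp add: abs_mult)
qed

lemma integrable_inner: "f \<in> L2 \<Omega> \<Longrightarrow> g \<in> L2 \<Omega> \<Longrightarrow> integrable (lebesgue_on \<Omega>) (\<lambda>x. f x \<bullet> g x)"
  using integrable_weighted_inner[of f \<Omega> g "\<lambda>x. 1" 1] by simp

lemma integrable_weighted_square:
  assumes "f \<in> L2 \<Omega>" "w \<in> borel_measurable (lebesgue_on \<Omega>)" "\<And>x. \<bar>w x\<bar> \<le> C"
  shows "integrable (lebesgue_on \<Omega>) (\<lambda>x. w x * (norm (f x))\<^sup>2)"
  using integrable_weighted_inner[OF assms(1,1,2,3)] by (simp add: power2_norm_eq_inner)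

lemma continuous_in_L2:
  fixes \<psi> :: "'a::euclidean_space \<Rightarrow> real"
  assumes \<Omega>: "open \<Omega>" "bounded \<Omega>" and \<psi>: "continuous_on UNIV \<psi>"
  shows "\<psi> \<in> L2 \<Omega>"
proof -
  have "bounded (\<psi> ` closure \<Omega>)"
    using \<Omega> by (intro compact_imp_bounded compact_continuous_image continuous_on_subset[OF \<psi>]) auto
  then obtain C where C: "\<And>x. x \<in> \<Omega> \<Longrightarrow> norm (\<psi> x) \<le> C"
    unfolding bounded_iff using closure_subset[of \<Omega>] by auto
  have m: "\<psi> \<in> borel_measurable (lebesgue_on \<Omega>)"
    using \<Omega> by (intro continuous_imp_measurable_on_sets_lebesgue continuous_on_subset[OF \<psi>]) (auto simp: borel_open)
  have "integrable (lebesgue_on \<Omega>) (\<lambda>x. C\<^sup>2)"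
  proof -
    have "\<Omega> \<in> lmeasurable" using \<Omega> by (simp add: lmeasurable_open)
    then have "finite_measure (lebesgue_on \<Omega>)" by (rule finite_measure_lebesgue_on)
    then show ?thesis by (rule finite_measure.integrable_const)
  qed
  with m show ?thesis
  proof (rule L2_I_bound)
    have "AE x in lebesgue_on \<Omega>. x \<in> \<Omega>" by (rule AE_I2) (simp add: space_restrict_space)
    then show "AE x in lebesgue_on \<Omega>. (norm (\<psi> x))\<^sup>2 \<le> C\<^sup>2"
    proof eventually_elim
      case (elim x)
      show ?case by (rule power_mono[OF C[OF elim] norm_ge_zero])
    qed
  qed
qed

section \<open>Weak gradients and strains up to null sets\<close>

context
  fixes \<Omega> :: "(real^'d::finite) set"
  assumes \<Omega>: "open \<Omega>" "bounded \<Omega>"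
begin

lemma test_function_in_L2:
  assumes "\<psi> \<in> test_functions \<Omega>"
  shows "\<psi> \<in> L2 \<Omega>" "partial_deriv j \<psi> \<in> L2 \<Omega>"
  using assms by (auto intro: continuous_in_L2[OF \<Omega>] test_function_continuous test_function_partial_deriv_continuous)

lemma L2_vec_nth: "g \<in> L2 \<Omega> \<Longrightarrow> (\<lambda>x. g x $ j) \<in> L2 \<Omega>" for g :: "real^'d \<Rightarrow> 'b::euclidean_space^'d"
proof (rule L2_I_bound[where b = "\<lambda>x. (norm (g x))\<^sup>2"])
  assume g: "g \<in> L2 \<Omega>"
  show "(\<lambda>x. g x $ j) \<in> borel_measurable (lebesgue_on \<Omega>)"
    using L2_measurable[OF g] by (rule borel_measurable_continuous_on[rotated]) (intro continuous_intros)
  show "integrable (lebesgue_on \<Omega>) (\<lambda>x. (norm (g x))\<^sup>2)" using g by (rule L2_integrable_norm_square)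
  show "AE x in lebesgue_on \<Omega>. (norm (g x $ j))\<^sup>2 \<le> (norm (g x))\<^sup>2"
    by (intro AE_I2 power_mono Finite_Cartesian_Product.norm_nth_le) simp
qed

lemma L2_vecI:
  fixes g :: "real^'d \<Rightarrow> 'b::euclidean_space^'n::finite"
  assumes g: "\<And>i. (\<lambda>x. g x $ i) \<in> L2 \<Omega>"
  shows "g \<in> L2 \<Omega>"
proof (rule L2_I_bound[where b = "\<lambda>x. \<Sum>i\<in>UNIV. (norm (g x $ i))\<^sup>2"])
  show "g \<in> borel_measurable (lebesgue_on \<Omega>)"
  proof (subst borel_measurable_euclidean_space, rule ballI)
    fix k :: "'b^'n" assume "k \<in> Basis"
    then obtain i b where "k = axis i b" by (auto simp: Basis_vec_def)
    then show "(\<lambda>x. g x \<bullet> k) \<in> borel_measurable (lebesgue_on \<Omega>)"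
      using L2_measurable[OF g[of i]] by (simp add: inner_axis)
  qed
  show "integrable (lebesgue_on \<Omega>) (\<lambda>x. \<Sum>i\<in>UNIV. (norm (g x $ i))\<^sup>2)"
    using L2_integrable_norm_square[OF g] by (intro Bochner_Integration.integrable_sum)
  show "AE x in lebesgue_on \<Omega>. (norm (g x))\<^sup>2 \<le> (\<Sum>i\<in>UNIV. (norm (g x $ i))\<^sup>2)"
    by (simp add: norm_vec_def L2_set_def sum_nonneg)
qed

lemma has_weak_gradient_sum:
  assumes I: "finite I" and g: "\<And>i. i \<in> I \<Longrightarrow> has_weak_gradient \<Omega> (v i) (g i)"
  shows "has_weak_gradient \<Omega> (\<lambda>x. \<Sum>i\<in>I. c i * v i x) (\<lambda>x. \<Sum>i\<in>I. c i *\<^sub>R g i x)"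
proof -
  have L: "v i \<in> L2 \<Omega>" "g i \<in> L2 \<Omega>" if "i \<in> I" for i
    using g[OF that] by (auto simp: has_weak_gradient_def)
  have "(LINT x|lebesgue_on \<Omega>. (\<Sum>i\<in>I. c i * v i x) * partial_deriv j \<psi> x)
      = - (LINT x|lebesgue_on \<Omega>. (\<Sum>i\<in>I. c i *\<^sub>R g i x) $ j * \<psi> x)"
    if \<psi>: "\<psi> \<in> test_functions \<Omega>" for \<psi> j
  proof -
    have "(LINT x|lebesgue_on \<Omega>. (\<Sum>i\<in>I. c i * v i x) * partial_deriv j \<psi> x)
        = (LINT x|lebesgue_on \<Omega>. (\<Sum>i\<in>I. c i * (v i x * partial_deriv j \<psi> x)))"
      by (simp add: sum_distrib_right mult.assoc)
    also have "\<dots> = (\<Sum>i\<in>I. c i * (LINT x|lebesgue_on \<Omega>. v i x * partial_deriv j \<psi> x))"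
      using integrable_inner[OF L(1) test_function_in_L2(2)[OF \<psi>]]
      by (subst Bochner_Integration.integral_sum) auto
    also have "\<dots> = (\<Sum>i\<in>I. c i * - (LINT x|lebesgue_on \<Omega>. g i x $ j * \<psi> x))"
      using g \<psi> by (intro sum.cong) (auto simp: has_weak_gradient_def)
    also have "\<dots> = - (LINT x|lebesgue_on \<Omega>. (\<Sum>i\<in>I. c i * (g i x $ j * \<psi> x)))"
      using integrable_inner[OF L2_vec_nth[OF L(2)] test_function_in_L2(1)[OF \<psi>]]
      by (subst Bochner_Integration.integral_sum) (auto simp: sum_negf)
    finally show ?thesis by (simp add: sum_distrib_right mult.assoc)
  qed
  moreover have "(\<lambda>x. \<Sum>i\<in>I. c i * v i x) \<in> L2 \<Omega>"
    using L2_sum[OF I, of v \<Omega> c] L by simp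
  ultimately show ?thesis
    unfolding has_weak_gradient_def using L L2_sum[OF I, of g \<Omega> c] by auto
qed

text \<open>The difference of the two gradients is orthogonal to every test function, so
  \<open>du_Bois_Reymond\<close> applies componentwise. This makes the representative chosen by
  \<open>weak_gradient\<close> harmless.\<close>

lemma weak_gradient_unique:
  assumes g: "has_weak_gradient \<Omega> v g" and g': "has_weak_gradient \<Omega> v' g'"
    and eq: "AE x in lebesgue_on \<Omega>. v x = v' x"
  shows "AE x in lebesgue_on \<Omega>. g x = g' x"
proof -
  have L: "v \<in> L2 \<Omega>" "v' \<in> L2 \<Omega>" "g \<in> L2 \<Omega>" "g' \<in> L2 \<Omega>"
    using g g' by (auto simp: has_weak_gradient_def)
  have "AE x in lebesgue_on \<Omega>. g x $ j - g' x $ j = 0" for j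
  proof (rule du_Bois_Reymond[OF \<Omega>(1)])
    have d: "(\<lambda>x. g x $ j - g' x $ j) \<in> L2 \<Omega>" using L by (intro L2_diff L2_vec_nth)
    \<comment> \<open>On a bounded set the constant 1 is square-integrable; pairing with it turns
      membership in \<open>L2\<close> into integrability.\<close>
    show "integrable (lebesgue_on \<Omega>) (\<lambda>x. g x $ j - g' x $ j)"
      using integrable_inner[OF d continuous_in_L2[OF \<Omega> continuous_on_const[of _ 1]]] by simp
    fix \<psi> assume \<psi>: "\<psi> \<in> test_functions \<Omega>"
    have "(LINT x|lebesgue_on \<Omega>. v x * partial_deriv j \<psi> x) = (LINT x|lebesgue_on \<Omega>. v' x * partial_deriv j \<psi> x)"
      using eq L(1,2)[THEN L2_measurable] test_function_in_L2(2)[OF \<psi>, THEN L2_measurable]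
      by (intro integral_cong_AE) auto
    then have "(LINT x|lebesgue_on \<Omega>. g x $ j * \<psi> x) = (LINT x|lebesgue_on \<Omega>. g' x $ j * \<psi> x)"
      using g g' \<psi> by (simp add: has_weak_gradient_def)
    then show "(LINT x|lebesgue_on \<Omega>. (g x $ j - g' x $ j) * \<psi> x) = 0"
      using integrable_inner[OF L2_vec_nth[OF L(3)] test_function_in_L2(1)[OF \<psi>]]
        integrable_inner[OF L2_vec_nth[OF L(4)] test_function_in_L2(1)[OF \<psi>]]
      by (simp add: left_diff_distrib Bochner_Integration.integral_diff)
  qed
  then have "AE x in lebesgue_on \<Omega>. \<forall>j\<in>UNIV. g x $ j - g' x $ j = 0"
    by (intro AE_finite_allI) auto
  then show ?thesis by eventually_elim (simp add: vec_eq_iff)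
qed

lemma H1_has_weak_gradient: "v \<in> H1 \<Omega> \<Longrightarrow> has_weak_gradient \<Omega> v (weak_gradient \<Omega> v)"
  unfolding H1_def weak_gradient_def mem_Collect_eq by (rule someI_ex[of "has_weak_gradient \<Omega> v"])

text \<open>The chosen gradient of \<open>w\<close> and the combination of the chosen gradients of
  the \<open>b i\<close> are both weak gradients of the same component, so they agree almost
  everywhere. Linearity of the strain is available only in this form.\<close>

lemma strain_sum:
  fixes b :: "'i \<Rightarrow> real^'d \<Rightarrow> real^'d"
  assumes I: "finite I" and b: "\<And>i. i \<in> I \<Longrightarrow> b i \<in> V_space \<Omega>" and w: "w \<in> V_space \<Omega>"
    and eq: "AE x in lebesgue_on \<Omega>. w x = (\<Sum>i\<in>I. c i *\<^sub>R b i x)"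
  shows "AE x in lebesgue_on \<Omega>. strain \<Omega> w x = (\<Sum>i\<in>I. c i *\<^sub>R strain \<Omega> (b i) x)"
proof -
  have H: "has_weak_gradient \<Omega> (\<lambda>x. u x $ k) (weak_gradient \<Omega> (\<lambda>x. u x $ k))" if "u \<in> V_space \<Omega>" for u k
    using that by (intro H1_has_weak_gradient) (auto simp: V_space_def H10_def)
  have "AE x in lebesgue_on \<Omega>. weak_gradient \<Omega> (\<lambda>y. w y $ k) x
      = (\<Sum>i\<in>I. c i *\<^sub>R weak_gradient \<Omega> (\<lambda>y. b i y $ k) x)" for k
  proof (rule weak_gradient_unique[OF H[OF w]])
    show "has_weak_gradient \<Omega> (\<lambda>x. \<Sum>i\<in>I. c i * b i x $ k)
        (\<lambda>x. \<Sum>i\<in>I. c i *\<^sub>R weak_gradient \<Omega> (\<lambda>y. b i y $ k) x)"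
      using H b by (intro has_weak_gradient_sum I) blast
    show "AE x in lebesgue_on \<Omega>. w x $ k = (\<Sum>i\<in>I. c i * b i x $ k)"
      using eq by eventually_elim simp
  qed
  then have "AE x in lebesgue_on \<Omega>. \<forall>k\<in>UNIV. weak_gradient \<Omega> (\<lambda>y. w y $ k) x
      = (\<Sum>i\<in>I. c i *\<^sub>R weak_gradient \<Omega> (\<lambda>y. b i y $ k) x)"
    by (intro AE_finite_allI) auto
  then show ?thesis
    by eventually_elim
      (simp add: vec_eq_iff strain_def jacobian_def sum.distrib[symmetric] sum_distrib_left[symmetric]
        sum_divide_distrib[symmetric] distrib_left[symmetric])
qed

lemma strain_L2: 
  assumes "w \<in> V_space \<Omega>"
  shows "strain \<Omega> w \<in> L2 \<Omega>"
proof -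
  have "weak_gradient \<Omega> (\<lambda>x. w x $ k) \<in> L2 \<Omega>" for k
    using assms H1_has_weak_gradient[of "\<lambda>x. w x $ k"] by (auto simp: V_space_def H10_def has_weak_gradient_def)
  then have J: "(\<lambda>x. jacobian \<Omega> w x $ k $ l) \<in> L2 \<Omega>" for k l
    unfolding jacobian_def by (simp add: L2_vec_nth)
  have e: "(\<lambda>x. strain \<Omega> w x $ k $ l) \<in> L2 \<Omega>" for k l
    using L2_scaleR[OF L2_add[OF J[of k l] J[of l k]], of "1/2"] by (simp add: strain_def)
  show ?thesis by (intro L2_vecI e)
qed

end

text \<open>A substitute for the equivalence of norms on a finite-dimensional space:
  \<open>G\<close> does not depend on the coefficients. The induction adds one function at a time
  and does not assume linear independence.\<close>

lemma L2_combination_pointwise_bound: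
  fixes b :: "'i \<Rightarrow> 'a::euclidean_space \<Rightarrow> 'b::euclidean_space"
  assumes "finite I" "\<And>i. i \<in> I \<Longrightarrow> b i \<in> L2 \<Omega>"
  shows "\<exists>G. integrable (lebesgue_on \<Omega>) G \<and> (\<forall>x. 0 \<le> G x) \<and>
    (\<forall>c. AE x in lebesgue_on \<Omega>. (norm (\<Sum>i\<in>I. c i *\<^sub>R b i x))\<^sup>2
       \<le> (LINT y|lebesgue_on \<Omega>. (norm (\<Sum>i\<in>I. c i *\<^sub>R b i y))\<^sup>2) * G x)"
  using assms
proof (induction I rule: finite_induct)
  case empty
  show ?case by (rule exI[of _ "\<lambda>_. 0"]) auto
next
  case (insert j I)
  define N where "N g = (LINT y|lebesgue_on \<Omega>. (norm (g y))\<^sup>2)" for g :: "'a \<Rightarrow> 'b"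
  define comb where "comb c x = (\<Sum>i\<in>I. c i *\<^sub>R b i x)" for c x
  have L: "comb c \<in> L2 \<Omega>" for c
    unfolding comb_def using insert by (intro L2_sum) auto
  have Lj: "b j \<in> L2 \<Omega>" using insert by auto
  obtain G where G: "integrable (lebesgue_on \<Omega>) G" "\<And>x. 0 \<le> G x"
    and bound: "\<And>c. AE x in lebesgue_on \<Omega>. (norm (comb c x))\<^sup>2 \<le> N (comb c) * G x"
    using insert unfolding N_def comb_def by auto
  have N_nonneg: "0 \<le> N g" for g unfolding N_def by (rule integral_nonneg_AE) simp
  have N_scale: "N (\<lambda>x. a *\<^sub>R g x) = a\<^sup>2 * N g" for a g
    unfolding N_def by (simp add: power_mult_distrib)
  have N_add: "N (\<lambda>x. g x + h x) \<le> 2 * N g + 2 * N h" if "g \<in> L2 \<Omega>" "h \<in> L2 \<Omega>" for g h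
  proof -
    have "N (\<lambda>x. g x + h x) \<le> (LINT x|lebesgue_on \<Omega>. 2 * (norm (g x))\<^sup>2 + 2 * (norm (h x))\<^sup>2)"
      unfolding N_def using L2_add[OF that] that
      by (intro integral_mono norm_add_square_le Bochner_Integration.integrable_add integrable_mult_right
          L2_integrable_norm_square)
    also have "\<dots> = 2 * N g + 2 * N h"
      unfolding N_def using that by (simp add: L2_integrable_norm_square)
    finally show ?thesis .
  qed
  have comb_scale: "a *\<^sub>R comb c x = comb (\<lambda>i. a * c i) x" for a c x
    by (simp add: comb_def scaleR_sum_right)
  have comb_add: "comb c x + comb c' x = comb (\<lambda>i. c i + c' i) x" for c c' x
    by (simp add: comb_def sum.distrib scaleR_left_distrib)
  have split: "(\<Sum>i\<in>insert j I. c i *\<^sub>R b i x) = c j *\<^sub>R b j x + comb c x" for c x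
    using insert by (simp add: comb_def)
  show ?case
  \<comment> \<open>Either \<open>b j\<close> keeps a positive distance from all combinations of the
    earlier functions, or it is a limit of such combinations.\<close>
  proof (cases "\<exists>m>0. \<forall>c. m \<le> N (\<lambda>x. b j x - comb c x)")
    case True
    then obtain m where m: "0 < m" "\<And>c. m \<le> N (\<lambda>x. b j x - comb c x)" by auto
    \<comment> \<open>The norm of the combination \<open>?g\<close> controls \<open>c j\<close> with
      constant \<open>1 / m\<close>, hence also the norm of \<open>comb c\<close>, which is
      \<open>?g\<close> minus \<open>c j\<close> times \<open>b j\<close>. The first summand bounds
      the part along \<open>b j\<close>, the second the part \<open>comb c\<close> through the old
      \<open>G\<close>.\<close>
    define G' where "G' x = 2 / m * (norm (b j x))\<^sup>2 + 2 * (2 + 2 / m * N (b j)) * G x" for x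
    have "AE x in lebesgue_on \<Omega>. (norm (c j *\<^sub>R b j x + comb c x))\<^sup>2 \<le> N (\<lambda>x. c j *\<^sub>R b j x + comb c x) * G' x" for c
    proof -
      let ?g = "\<lambda>x. c j *\<^sub>R b j x + comb c x"
      have Lg: "?g \<in> L2 \<Omega>" by (intro L2_add L2_scaleR Lj L)
      have cj: "(c j)\<^sup>2 \<le> N ?g / m"
      proof (cases "c j = 0")
        case False
        \<comment> \<open>Factoring out \<open>c j\<close> leaves \<open>b j\<close> minus an
          earlier combination, whose squared norm is at least \<open>m\<close>.\<close>
        have "N ?g = N (\<lambda>x. c j *\<^sub>R (b j x - comb (\<lambda>i. - (c i / c j)) x))"
          using False by (simp add: scaleR_diff_right comb_scale) (simp add: comb_def sum_negf)
        also have "\<dots> \<ge> (c j)\<^sup>2 * m" unfolding N_scale by (intro mult_left_mono m) simp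
        finally show ?thesis using m by (simp add: field_simps)
      qed (use m N_nonneg in simp)
      have "N (comb c) = N (\<lambda>x. ?g x + (- c j) *\<^sub>R b j x)" by simp
      also have "\<dots> \<le> 2 * N ?g + 2 * ((c j)\<^sup>2 * N (b j))"
        using N_add[OF Lg L2_scaleR[OF Lj], of "- c j"] unfolding N_scale by simp
      also have "\<dots> \<le> 2 * N ?g + 2 * (N ?g / m * N (b j))"
        by (intro add_left_mono mult_left_mono mult_right_mono cj N_nonneg) simp
      finally have Nh: "N (comb c) \<le> N ?g * (2 + 2 / m * N (b j))" by (simp add: algebra_simps)
      show ?thesis using bound[of c]
      proof eventually_elim
        case (elim x)
        have "(norm (?g x))\<^sup>2 \<le> 2 * ((c j)\<^sup>2 * (norm (b j x))\<^sup>2) + 2 * (norm (comb c x))\<^sup>2"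
          using norm_add_square_le[of "c j *\<^sub>R b j x" "comb c x"] by (simp add: power_mult_distrib)
        also have "\<dots> \<le> 2 * (N ?g / m * (norm (b j x))\<^sup>2) + 2 * (N ?g * (2 + 2 / m * N (b j)) * G x)"
          using order_trans[OF elim mult_right_mono[OF Nh G(2)[of x]]]
          by (intro add_mono mult_left_mono mult_right_mono cj) auto
        also have "\<dots> = N ?g * G' x" by (simp add: G'_def algebra_simps)
        finally show ?case .
      qed
    qed
    moreover have "integrable (lebesgue_on \<Omega>) G'"
      unfolding G'_def using G L2_integrable_norm_square[OF Lj]
      by (intro Bochner_Integration.integrable_add integrable_mult_right)
    moreover have "0 \<le> G' x" for x
      unfolding G'_def using G m N_nonneg[of "b j"] by (intro add_nonneg_nonneg mult_nonneg_nonneg) auto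
    ultimately show ?thesis unfolding split N_def by (intro exI[of _ G']) auto
  next
    case False
    have "AE x in lebesgue_on \<Omega>. (norm (c j *\<^sub>R b j x + comb c x))\<^sup>2 \<le> N (\<lambda>x. c j *\<^sub>R b j x + comb c x) * (4 * G x)" for c
    proof -
      let ?g = "\<lambda>x. c j *\<^sub>R b j x + comb c x"
      have Lg: "?g \<in> L2 \<Omega>" by (intro L2_add L2_scaleR Lj L)
      \<comment> \<open>\<open>Z\<close> is the excess over the claimed bound. The 4 collects a 2
        from splitting the value of \<open>?g\<close> into \<open>?r\<close> and \<open>?k\<close>
        and a 2 from splitting the norm of \<open>?k\<close>. What remains involves only the
        approximation error \<open>?r\<close> and integrates to \<open>K\<close> times its squared
        norm, which can be made arbitrarily small.\<close>
      define Z where "Z x = max 0 ((norm (?g x))\<^sup>2 - N ?g * (4 * G x))" for x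
      define K where "K = 2 + 4 * (LINT x|lebesgue_on \<Omega>. G x)"
      have "0 \<le> (LINT x|lebesgue_on \<Omega>. G x)" using G by (intro integral_nonneg_AE) simp
      then have K: "0 < K" by (simp add: K_def)
      have iZ: "integrable (lebesgue_on \<Omega>) Z"
        unfolding Z_def using G Lg by (intro integrable_max) (auto intro: L2_integrable_norm_square)
      have Zm: "(LINT x|lebesgue_on \<Omega>. Z x) \<le> K * ((c j)\<^sup>2 * m)" if "0 < m" for m
      proof -
        have "\<not> (\<forall>d. m \<le> N (\<lambda>x. b j x - comb d x))" using False that by blast
        then obtain d where d: "N (\<lambda>x. b j x - comb d x) < m" by (auto simp: not_le)
        \<comment> \<open>Replacing \<open>b j\<close> in \<open>?g\<close> by its approximation
          \<open>comb d\<close> yields the earlier combination \<open>?k\<close>, to which the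
          induction hypothesis applies.\<close>
        let ?k = "comb (\<lambda>i. c j * d i + c i)"
        let ?r = "\<lambda>x. c j *\<^sub>R (b j x - comb d x)"
        have Lr: "?r \<in> L2 \<Omega>" by (intro L2_scaleR L2_diff Lj L)
        have gk: "?g x = ?r x + ?k x" for x
          by (simp add: comb_add[symmetric] comb_scale[symmetric] scaleR_diff_right)
        have "N ?k = N (\<lambda>x. ?g x + (- 1) *\<^sub>R ?r x)" unfolding gk by simp
        also have "\<dots> \<le> 2 * N ?g + 2 * N ?r"
          using N_add[OF Lg L2_scaleR[OF Lr], of "- 1"] N_scale[of "- 1" ?r] by simp
        finally have Nk: "N ?k \<le> 2 * N ?g + 2 * N ?r" .
        have "AE x in lebesgue_on \<Omega>. Z x \<le> 2 * (norm (?r x))\<^sup>2 + 4 * N ?r * G x"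
          using bound[of "\<lambda>i. c j * d i + c i"]
        proof eventually_elim
          case (elim x)
          have "(norm (?g x))\<^sup>2 \<le> 2 * (norm (?r x))\<^sup>2 + 2 * (norm (?k x))\<^sup>2"
            unfolding gk by (rule norm_add_square_le)
          also have "\<dots> \<le> 2 * (norm (?r x))\<^sup>2 + 2 * ((2 * N ?g + 2 * N ?r) * G x)"
            using order_trans[OF elim mult_right_mono[OF Nk G(2)[of x]]] by simp
          finally have "(norm (?g x))\<^sup>2 - N ?g * (4 * G x) \<le> 2 * (norm (?r x))\<^sup>2 + 4 * N ?r * G x"
            by (simp add: algebra_simps)
          moreover have "0 \<le> 2 * (norm (?r x))\<^sup>2 + 4 * N ?r * G x"
            using G N_nonneg[of ?r] by (intro add_nonneg_nonneg mult_nonneg_nonneg) auto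
          ultimately show ?case by (simp add: Z_def)
        qed
        then have "(LINT x|lebesgue_on \<Omega>. Z x) \<le> (LINT x|lebesgue_on \<Omega>. 2 * (norm (?r x))\<^sup>2 + 4 * N ?r * G x)"
          using iZ G L2_integrable_norm_square[OF Lr]
          by (intro integral_mono_AE Bochner_Integration.integrable_add integrable_mult_right)
        also have "\<dots> = (LINT x|lebesgue_on \<Omega>. 2 * (norm (?r x))\<^sup>2) + (LINT x|lebesgue_on \<Omega>. 4 * N ?r * G x)"
          using G L2_integrable_norm_square[OF Lr]
          by (intro Bochner_Integration.integral_add integrable_mult_right)
        also have "\<dots> = K * N ?r"
          by (simp only: integral_mult_right_zero N_def[of ?r, symmetric] K_def) (simp add: algebra_simps)
        also have "\<dots> \<le> K * ((c j)\<^sup>2 * m)"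
          unfolding N_scale using K d by (intro mult_left_mono) auto
        finally show ?thesis .
      qed
      have "(LINT x|lebesgue_on \<Omega>. Z x) \<le> 0"
      proof (rule field_le_epsilon)
        fix e :: real assume "0 < e"
        \<comment> \<open>Chosen to make \<open>K * ((c j)\<^sup>2 + 1) * m\<close> equal to
          \<open>e\<close>; adding 1 keeps the divisor positive when \<open>c j = 0\<close>.\<close>
        define m where "m = e / (K * ((c j)\<^sup>2 + 1))"
        have "0 < K * ((c j)\<^sup>2 + 1)" using K by (simp add: add_nonneg_pos)
        then have "0 < m" "K * ((c j)\<^sup>2 + 1) * m = e" using \<open>0 < e\<close> unfolding m_def
          by (auto simp only: divide_pos_pos nonzero_mult_div_cancel_left times_divide_eq_right)
        moreover have "K * ((c j)\<^sup>2 * m) \<le> K * ((c j)\<^sup>2 + 1) * m"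
          using K \<open>0 < m\<close> by (simp add: algebra_simps)
        ultimately show "(LINT x|lebesgue_on \<Omega>. Z x) \<le> 0 + e" using Zm[of m] by simp
      qed
      moreover have Z_nonneg: "AE x in lebesgue_on \<Omega>. 0 \<le> Z x" by (simp add: Z_def)
      moreover have "0 \<le> (LINT x|lebesgue_on \<Omega>. Z x)" by (rule integral_nonneg_AE[OF Z_nonneg])
      ultimately have "AE x in lebesgue_on \<Omega>. Z x = 0"
        using integral_nonneg_eq_0_iff_AE[OF iZ Z_nonneg] by linarith
      then show ?thesis by eventually_elim (simp add: Z_def max_def split: if_splits)
    qed
    then show ?thesis unfolding split N_def using G by (intro exI[of _ "\<lambda>x. 4 * G x"]) auto
  qed
qed

subsection \<open>The relaxed viscosity\<close>

lemma square_powr_half: "0 < z \<Longrightarrow> (z\<^sup>2) powr (a / 2) = z powr a" for z a :: real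
proof -
  assume "0 < z"
  then have "(z\<^sup>2) powr (a / 2) = z powr (2 * (a / 2))"
    by (simp only: powr_powr flip: powr_numeral)
  then show ?thesis by simp
qed

text \<open>The constant branches are the values of the power law at the ends of its range. A single
  power of a clamped argument replaces the three branches in proofs of continuity and
  monotonicity.\<close>

lemma mu_eps_eq_clamp:
  assumes "0 < em" "em < ep"
  shows "mu_eps r em ep t = (max (em\<^sup>2) (min (ep\<^sup>2) t)) powr ((r - 2) / 2)"
proof -
  have e: "(em\<^sup>2) powr ((r-2)/2) = em powr (r-2)" "(ep\<^sup>2) powr ((r-2)/2) = ep powr (r-2)"
    using assms by (simp_all only: square_powr_half)
  have "em\<^sup>2 < ep\<^sup>2" using assms by (simp add: power_strict_mono)
  then show ?thesis
    unfolding mu_eps_def using e by (auto simp: max_def min_def)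
qed

locale viscosity =
  fixes r em ep :: real
  assumes r: "1 < r" "r < 2" and eps: "0 < em" "em < ep"
begin

abbreviation "\<mu> \<equiv> mu_eps r em ep"
abbreviation "\<phi> \<equiv> phi_eps r em ep"

lemma eps_sq: "0 < em\<^sup>2" "em\<^sup>2 < ep\<^sup>2"
  using eps by (simp_all add: power_strict_mono)

lemmas \<mu>_clamp = mu_eps_eq_clamp[OF eps, of r]

lemma clamp_pos: "0 < max (em\<^sup>2) (min (ep\<^sup>2) t)"
  using eps_sq by linarith

lemma \<mu>_antimono: "s \<le> t \<Longrightarrow> \<mu> t \<le> \<mu> s"
proof -
  assume "s \<le> t"
  then have "max (em\<^sup>2) (min (ep\<^sup>2) s) \<le> max (em\<^sup>2) (min (ep\<^sup>2) t)" by linarith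
  then show ?thesis
    unfolding \<mu>_clamp using clamp_pos[of s] r by (intro powr_mono2') simp_all
qed

lemma \<mu>_le: "\<mu> t \<le> em powr (r - 2)"
proof -
  have "min t 0 < em\<^sup>2" using eps_sq by linarith
  then show ?thesis using \<mu>_antimono[of "min t 0" t] by (simp add: mu_eps_def[of _ _ _ "min t 0"])
qed

lemma \<mu>_ge: "ep powr (r - 2) \<le> \<mu> t"
proof -
  have "\<not> max t (ep\<^sup>2 + 1) < em\<^sup>2" "\<not> max t (ep\<^sup>2 + 1) \<le> ep\<^sup>2" using eps_sq by linarith+
  then have "\<mu> (max t (ep\<^sup>2 + 1)) = ep powr (r - 2)"
    unfolding mu_eps_def by (simp only: if_False)
  then show ?thesis
    using \<mu>_antimono[of t "max t (ep\<^sup>2 + 1)"] by simp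
qed

lemma \<mu>_pos: "0 < \<mu> t"
  using eps by (intro less_le_trans[OF _ \<mu>_ge]) simp

lemma continuous_\<mu>: "continuous_on S \<mu>"
  unfolding \<mu>_clamp using clamp_pos by (intro continuous_intros) (auto simp: less_imp_neq[symmetric])

lemma isCont_\<mu>: "isCont \<mu> t"
  using continuous_\<mu>[of UNIV] by (simp add: continuous_on_eq_continuous_at)

text \<open>Between two points \<open>\<mu>\<close> varies no more than the pure power law; all lower bounds rest on this.\<close>

lemma \<mu>_ratio:
  assumes "0 < s" "s \<le> t"
  shows "\<mu> s * s powr ((2 - r) / 2) \<le> \<mu> t * t powr ((2 - r) / 2)"
proof -
  let ?c = "\<lambda>t. max (em\<^sup>2) (min (ep\<^sup>2) t)"
  \<comment> \<open>This reduces the claim to monotonicity of \<open>t / ?c t\<close>, which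
    increases below \<open>em\<^sup>2\<close>, equals 1 in the middle range and increases again
    above \<open>ep\<^sup>2\<close>.\<close>
  have eq: "\<mu> t * t powr ((2 - r) / 2) = (t / ?c t) powr ((2 - r) / 2)" if "0 < t" for t
  proof -
    have e: "(r-2)/2 = - ((2-r)/2)" by (simp add: field_simps)
    show ?thesis
      unfolding \<mu>_clamp e powr_minus using that clamp_pos[of t] by (simp add: powr_divide field_simps)
  qed
  have "s / ?c s \<le> t / ?c t"
  proof -
    have "s * ?c t \<le> t * ?c s"
    proof -
      consider "t \<le> em\<^sup>2" | "em\<^sup>2 \<le> t" "t \<le> ep\<^sup>2" | "ep\<^sup>2 \<le> t" by linarith
      then show ?thesis
      proof cases
        case 1
        then have "?c s = em\<^sup>2" "?c t = em\<^sup>2" using assms eps_sq by linarith+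
        then show ?thesis using assms by (simp add: mult_right_mono)
      next
        case 2
        then have "?c t = t" "s \<le> ?c s" using assms by linarith+
        then show ?thesis using assms by (simp add: mult.commute mult_left_mono)
      next
        case 3
        then have "?c t = ep\<^sup>2" "min s (ep\<^sup>2) \<le> ?c s" using eps_sq assms by linarith+
        moreover have "s * ep\<^sup>2 \<le> t * min s (ep\<^sup>2)"
        proof (cases "s \<le> ep\<^sup>2")
          case True
          then show ?thesis using mult_left_mono[OF 3, of s] assms by (simp add: mult.commute)
        next
          case False
          then show ?thesis using mult_right_mono[OF \<open>s \<le> t\<close>, of "ep\<^sup>2"] by simp
        qed
        moreover have "t * min s (ep\<^sup>2) \<le> t * ?c s"
          using assms calculation(2) by (intro mult_left_mono) auto
        ultimately show ?thesis by simp
      qed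
    qed
    then show ?thesis using clamp_pos[of s] clamp_pos[of t] by (simp add: pos_le_divide_eq pos_divide_le_eq mult.commute)
  qed
  then show ?thesis
    using assms r clamp_pos[of s] by (simp only: eq) (intro powr_mono2, auto)
qed

text \<open>\<open>\<mu>_ratio\<close> bounds the stress at \<open>x\<close> by
  \<open>\<mu> (y\<^sup>2)\<close> times the weighted geometric mean of \<open>y\<close> and
  \<open>x\<close> with weights \<open>2 - r\<close> and \<open>r - 1\<close>; Young's inequality
  replaces that by the arithmetic mean.\<close>

lemma stress_strongly_monotone:
  assumes "0 \<le> x" "x \<le> y"
  shows "(r - 1) * \<mu> (y\<^sup>2) * (y - x) \<le> \<mu> (y\<^sup>2) * y - \<mu> (x\<^sup>2) * x"
proof (cases "x = 0")
  case True
  then have "(r-1) * (\<mu> (y\<^sup>2) * y) \<le> 1 * (\<mu> (y\<^sup>2) * y)"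
    using assms r \<mu>_pos[of "y\<^sup>2"] by (intro mult_right_mono) auto
  then show ?thesis using True by (simp add: mult_ac)
next
  case False
  then have xy: "0 < x" "0 < y" using assms by auto
  have pw: "(z\<^sup>2) powr ((2-r)/2) = z powr (2-r)" if "0 < z" for z :: real
    using that by (rule square_powr_half)
  have "\<mu> (x\<^sup>2) * x powr (2-r) \<le> \<mu> (y\<^sup>2) * y powr (2-r)"
    using \<mu>_ratio[of "x\<^sup>2" "y\<^sup>2"] assms xy unfolding pw[OF xy(1)] pw[OF xy(2)] by (simp add: power_mono)
  then have "\<mu> (x\<^sup>2) * x powr (2-r) * x powr (r-1) \<le> \<mu> (y\<^sup>2) * y powr (2-r) * x powr (r-1)"
    by (intro mult_right_mono) auto
  moreover have "x powr (2-r) * x powr (r-1) = x"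
    using xy by (simp flip: powr_add)
  ultimately have "\<mu> (x\<^sup>2) * x \<le> \<mu> (y\<^sup>2) * (y powr (2-r) * x powr (r-1))"
    by (simp add: mult.assoc)
  also have "\<dots> \<le> \<mu> (y\<^sup>2) * ((2-r) * y + (r-1) * x)"
    using Youngs_inequality_0[of "2-r" "r-1" y x] r xy \<mu>_pos[of "y\<^sup>2"]
    by (intro mult_left_mono) auto
  finally show ?thesis by (simp add: algebra_simps)
qed

section \<open>The energy density and its Bregman distance\<close>

lemma \<phi>_has_derivative_within:
  assumes "0 \<le> s" "s \<le> R"
  shows "(\<phi> has_real_derivative (1/2) * \<mu> s) (at s within {0..R})"
  unfolding phi_eps_def[abs_def]
  using integral_has_real_derivative[OF continuous_\<mu>, of s 0 R] assms
  by (intro DERIV_cmult) auto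

lemma continuous_\<phi>: "continuous_on {0..R} \<phi>"
  by (rule DERIV_continuous_on, rule \<phi>_has_derivative_within) auto

lemma \<phi>_has_derivative:
  assumes "0 < s"
  shows "(\<phi> has_real_derivative (1/2) * \<mu> s) (at s)"
  using \<phi>_has_derivative_within[of s "s + 1"] assms
  by (simp add: at_within_Icc_at)

lemma \<phi>_0 [simp]: "\<phi> 0 = 0"
  by (simp add: phi_eps_def)

lemma \<phi>_diff:
  assumes "0 \<le> t" "t \<le> s"
  shows "\<exists>\<xi>. t \<le> \<xi> \<and> \<xi> \<le> s \<and> \<phi> s - \<phi> t = (1/2) * \<mu> \<xi> * (s - t)"
proof (cases "t = s")
  case False
  then have "t < s" using assms by simp
  have "continuous_on {t..s} \<phi>"
    using assms by (intro continuous_on_subset[OF continuous_\<phi>[of s]]) auto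
  moreover have "\<phi> differentiable (at x)" if "t < x" for x
    using \<phi>_has_derivative[of x] that assms real_differentiable_def by auto
  ultimately obtain l \<xi> where "t < \<xi>" "\<xi> < s" "(\<phi> has_real_derivative l) (at \<xi>)" "\<phi> s - \<phi> t = (s - t) * l"
    using MVT[OF \<open>t < s\<close>, of \<phi>] by auto
  moreover from this have "l = (1/2) * \<mu> \<xi>"
    using \<phi>_has_derivative[of \<xi>] assms by (intro DERIV_unique) auto
  ultimately show ?thesis by (intro exI[of _ \<xi>]) auto
qed auto

lemma \<phi>_concave:
  assumes "0 \<le> s" "0 \<le> t"
  shows "\<phi> s - \<phi> t \<le> (1/2) * \<mu> t * (s - t)"
proof (cases "t \<le> s")
  case True
  then obtain \<xi> where "t \<le> \<xi>" "\<phi> s - \<phi> t = (1/2) * \<mu> \<xi> * (s - t)"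
    using \<phi>_diff[of t s] assms by auto
  then show ?thesis using \<mu>_antimono[of t \<xi>] True by (auto intro: mult_right_mono)
next
  case False
  then obtain \<xi> where "\<xi> \<le> t" "\<phi> t - \<phi> s = (1/2) * \<mu> \<xi> * (t - s)"
    using \<phi>_diff[of s t] assms by auto
  moreover have "\<mu> t * (t - s) \<le> \<mu> \<xi> * (t - s)"
    using \<mu>_antimono[of \<xi> t] False \<open>\<xi> \<le> t\<close> by (auto intro: mult_right_mono)
  ultimately show ?thesis by (simp add: algebra_simps)
qed

lemma \<phi>_bounds:
  assumes "0 \<le> s"
  shows "0 \<le> \<phi> s" "\<phi> s \<le> (1/2) * em powr (r - 2) * s"
proof -
  obtain \<xi> where x: "\<phi> s = (1/2) * \<mu> \<xi> * s"
    using \<phi>_diff[of 0 s] assms by auto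
  show "0 \<le> \<phi> s" unfolding x using assms \<mu>_pos[of \<xi>] by auto
  show "\<phi> s \<le> (1/2) * em powr (r - 2) * s" unfolding x using assms \<mu>_le[of \<xi>]
    by (auto intro: mult_right_mono)
qed

text \<open>On a plateau of \<open>\<mu>\<close> the mean value is exact. The plateaus are closed,
  so that limit points on a kink are covered.\<close>

lemma \<phi>_affine:
  assumes "0 \<le> s" "0 \<le> t" "(s \<le> em\<^sup>2 \<and> t \<le> em\<^sup>2) \<or> (ep\<^sup>2 \<le> s \<and> ep\<^sup>2 \<le> t)"
  shows "\<phi> s - \<phi> t = (1/2) * \<mu> t * (s - t)"
proof -
  have c: "\<mu> \<xi> = \<mu> t" if "min s t \<le> \<xi>" "\<xi> \<le> max s t" for \<xi>
  proof -
    have "max (em\<^sup>2) (min (ep\<^sup>2) \<xi>) = max (em\<^sup>2) (min (ep\<^sup>2) t)"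
      using that assms(3)
    proof (elim disjE conjE)
      assume "s \<le> em\<^sup>2" "t \<le> em\<^sup>2"
      then have "\<xi> \<le> em\<^sup>2" using that(2) by linarith
      then show ?thesis using \<open>t \<le> em\<^sup>2\<close> by simp
    next
      assume "ep\<^sup>2 \<le> s" "ep\<^sup>2 \<le> t"
      then have "ep\<^sup>2 \<le> \<xi>" using that(1) by linarith
      then show ?thesis using \<open>ep\<^sup>2 \<le> t\<close> by simp
    qed
    then show ?thesis unfolding \<mu>_clamp by simp
  qed
  show ?thesis
  proof (cases "t \<le> s")
    case True
    then obtain \<xi> where "t \<le> \<xi>" "\<xi> \<le> s" "\<phi> s - \<phi> t = (1/2) * \<mu> \<xi> * (s - t)"
      using \<phi>_diff[of t s] assms by auto
    then show ?thesis using c[of \<xi>] by simp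
  next
    case False
    then obtain \<xi> where "s \<le> \<xi>" "\<xi> \<le> t" "\<phi> t - \<phi> s = (1/2) * \<mu> \<xi> * (t - s)"
      using \<phi>_diff[of s t] assms by auto
    moreover from this have "\<mu> \<xi> = \<mu> t" using c[of \<xi>] by simp
    ultimately show ?thesis by (simp add: algebra_simps)
  qed
qed

text \<open>The difference \<open>k\<close> of the tangent gap and the quadratic has a minimum at
  \<open>b\<close>, because strong monotonicity of the stress fixes the sign of \<open>k'\<close> on
  both sides of \<open>b\<close>.\<close>

lemma radial_tangent_bound:
  assumes a: "0 \<le> a" and b: "0 \<le> b"
  defines "m \<equiv> (r - 1) * \<mu> ((max a b)\<^sup>2)"
  shows "(1/2) * m * (a - b)\<^sup>2 \<le> \<phi> (a\<^sup>2) - \<phi> (b\<^sup>2) - \<mu> (b\<^sup>2) * b * (a - b)"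
proof -
  define k where "k x = \<phi> (x\<^sup>2) - \<mu> (b\<^sup>2) * b * (x - b) - (1/2) * m * (x - b)\<^sup>2" for x
  define k' where "k' x = \<mu> (x\<^sup>2) * x - \<mu> (b\<^sup>2) * b - m * (x - b)" for x
  have der: "(k has_real_derivative k' x) (at x)" if "0 < x" for x
  proof -
    have "((\<lambda>x. x\<^sup>2) has_real_derivative 2 * x) (at x)"
      by (auto intro!: derivative_eq_intros)
    moreover have "(\<phi> has_real_derivative (1/2) * \<mu> (x\<^sup>2)) (at (x\<^sup>2))"
      using that by (intro \<phi>_has_derivative) simp
    ultimately have "((\<lambda>x. \<phi> (x\<^sup>2)) has_real_derivative (1/2) * \<mu> (x\<^sup>2) * (2 * x)) (at x)"
      by (rule DERIV_chain2[rotated])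
    then have "(k has_real_derivative (1/2) * \<mu> (x\<^sup>2) * (2 * x) - \<mu> (b\<^sup>2) * b * 1
        - (1/2) * m * (2 * (x - b))) (at x)"
      unfolding k_def by (intro DERIV_diff DERIV_cmult) (auto intro!: derivative_eq_intros)
    moreover have "(1/2) * \<mu> (x\<^sup>2) * (2 * x) - \<mu> (b\<^sup>2) * b * 1 - (1/2) * m * (2 * (x - b)) = k' x"
      unfolding k'_def by simp
    ultimately show ?thesis by simp
  qed
  have cont: "continuous_on {0..max a b} k"
    unfolding k_def
    by (intro continuous_intros continuous_on_compose2[OF continuous_\<phi>[of "(max a b)\<^sup>2"]])
       (auto simp: power_mono)
  have "k b \<le> k a"
  proof (cases "b \<le> a")
    case True
    have "0 \<le> k' x" if "b < x" "x < a" for x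
    proof -
      \<comment> \<open>Strong monotonicity yields the constant at the larger point. Here that is
        \<open>x < a\<close>, and \<open>\<mu>\<close> is nonincreasing; on the other side of
        \<open>b\<close> it is \<open>b\<close> itself, the maximum.\<close>
      have "m * (x - b) \<le> (r - 1) * \<mu> (x\<^sup>2) * (x - b)"
        unfolding m_def using that r b True
        by (intro mult_right_mono mult_left_mono \<mu>_antimono) (auto intro: power_mono)
      also have "\<dots> \<le> \<mu> (x\<^sup>2) * x - \<mu> (b\<^sup>2) * b"
        using stress_strongly_monotone[of b x] that b by simp
      finally show ?thesis by (simp add: k'_def)
    qed
    then have "\<exists>y. (k has_real_derivative y) (at x) \<and> 0 \<le> y" if "b < x" "x < a" for x
      using der[of x] that b by auto
    then show ?thesis
      using True b by (intro DERIV_nonneg_imp_increasing_open[of b a k] continuous_on_subset[OF cont]) auto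
  next
    case False
    have "k' x \<le> 0" if "a < x" "x < b" for x
    proof -
      have "m * (b - x) = (r - 1) * \<mu> (b\<^sup>2) * (b - x)"
        unfolding m_def using False by (simp add: max_def)
      then show ?thesis using stress_strongly_monotone[of x b] that a
        by (simp add: k'_def algebra_simps)
    qed
    then have "\<exists>y. (k has_real_derivative y) (at x) \<and> y \<le> 0" if "a < x" "x < b" for x
      using der[of x] that a by auto
    then show ?thesis
      using False a by (intro DERIV_nonpos_imp_decreasing_open[of a b k] continuous_on_subset[OF cont]) auto
  qed
  then show ?thesis by (simp add: k_def)
qed

text \<open>Since \<open>\<phi>\<close> has derivative \<open>\<mu> / 2\<close>, the gradient of
  \<open>\<phi>(|.|^2)\<close> at \<open>q\<close> is \<open>\<mu> ((norm q)\<^sup>2)\<close> times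
  \<open>q\<close>.\<close>

definition bregman :: "'a::real_inner \<Rightarrow> 'a \<Rightarrow> real" where
  "bregman q p = \<phi> ((norm p)\<^sup>2) - \<phi> ((norm q)\<^sup>2) - \<mu> ((norm q)\<^sup>2) * (q \<bullet> (p - q))"

text \<open>The distance splits exactly into the radial tangent gap and
  \<open>\<mu> ((norm q)\<^sup>2) / 2\<close> times the amount by which the squared distance of
  \<open>p\<close> and \<open>q\<close> exceeds that of their norms. The excess is nonnegative, and
  its coefficient dominates the radial one.\<close>

lemma bregman_lower:
  "(1/2) * ((r - 1) * \<mu> ((max (norm p) (norm q))\<^sup>2)) * (norm (p - q))\<^sup>2 \<le> bregman q p"
proof -
  let ?a = "norm p" and ?b = "norm q" and ?m = "(r - 1) * \<mu> ((max (norm p) (norm q))\<^sup>2)"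
  have s: "(norm (p - q))\<^sup>2 = ?a\<^sup>2 - 2 * (q \<bullet> p) + ?b\<^sup>2"
    by (simp add: power2_norm_eq_inner algebra_simps inner_commute)
  have eq: "bregman q p = (\<phi> (?a\<^sup>2) - \<phi> (?b\<^sup>2) - \<mu> (?b\<^sup>2) * ?b * (?a - ?b))
      + (1/2) * \<mu> (?b\<^sup>2) * ((norm (p - q))\<^sup>2 - (?a - ?b)\<^sup>2)"
    unfolding bregman_def s
    by (simp add: inner_diff_right power2_norm_eq_inner[symmetric] power2_diff field_simps)
       (simp add: power2_eq_square)
  have "(?a - ?b)\<^sup>2 \<le> (norm (p - q))\<^sup>2"
    using norm_triangle_ineq3[of p q] by (metis abs_le_square_iff abs_norm_cancel)
  moreover have "?m \<le> 1 * \<mu> (?b\<^sup>2)"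
    using r \<mu>_pos by (intro mult_mono \<mu>_antimono) (auto simp: less_imp_le power_mono)
  ultimately have "?m * ((norm (p - q))\<^sup>2 - (?a - ?b)\<^sup>2) \<le> \<mu> (?b\<^sup>2) * ((norm (p - q))\<^sup>2 - (?a - ?b)\<^sup>2)"
    by (intro mult_right_mono) auto
  then show ?thesis
    using radial_tangent_bound[of ?a ?b] unfolding eq by (simp add: algebra_simps)
qed

lemma bregman_strong: "(1/2) * ((r - 1) * ep powr (r - 2)) * (norm (p - q))\<^sup>2 \<le> bregman q p"
proof -
  have "(1/2) * ((r - 1) * ep powr (r - 2)) * (norm (p - q))\<^sup>2
    \<le> (1/2) * ((r - 1) * \<mu> ((max (norm p) (norm q))\<^sup>2)) * (norm (p - q))\<^sup>2"
    using r by (intro mult_right_mono mult_left_mono \<mu>_ge) auto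
  then show ?thesis using bregman_lower[of p q] by simp
qed

lemma bregman_nonneg: "0 \<le> bregman q p"
proof -
  have "0 \<le> (1/2) * ((r - 1) * ep powr (r - 2)) * (norm (p - q))\<^sup>2" using r by simp
  then show ?thesis using bregman_strong[of p q] by linarith
qed

lemma bregman_affine:
  assumes "(norm p \<le> em \<and> norm q \<le> em) \<or> (ep \<le> norm p \<and> ep \<le> norm q)"
  shows "bregman q p = (1/2) * \<mu> ((norm q)\<^sup>2) * (norm (p - q))\<^sup>2"
proof -
  have s: "(norm (p - q))\<^sup>2 = (norm p)\<^sup>2 - 2 * (q \<bullet> p) + (norm q)\<^sup>2"
    by (simp add: power2_norm_eq_inner algebra_simps inner_commute)
  have "\<phi> ((norm p)\<^sup>2) - \<phi> ((norm q)\<^sup>2) = (1/2) * \<mu> ((norm q)\<^sup>2) * ((norm p)\<^sup>2 - (norm q)\<^sup>2)"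
    using assms eps by (intro \<phi>_affine) (auto intro: power_mono)
  then show ?thesis
    unfolding bregman_def s
    by (simp add: inner_diff_right power2_norm_eq_inner[symmetric] field_simps)
qed

text \<open>The slack between the factors 1/2 and 1/8 is 4. By continuity and positivity of
  \<open>\<mu>\<close> it absorbs the difference between the viscosity at \<open>q\<close> and at
  the larger of the two norms.\<close>

lemma eventually_bregman_lower:
  fixes p :: "'a::real_inner"
  shows "\<forall>\<^sub>F q in nhds p. (r - 1) / 8 * \<mu> ((norm q)\<^sup>2) * (norm (p - q))\<^sup>2 \<le> bregman q p"
proof -
  have "((\<lambda>q. \<mu> ((norm q)\<^sup>2)) \<longlongrightarrow> \<mu> ((norm p)\<^sup>2)) (nhds p)"
    by (intro isCont_tendsto_compose[OF isCont_\<mu>] tendsto_intros filterlim_ident)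
  moreover have "\<mu> ((norm p)\<^sup>2) < 4 * \<mu> ((norm p)\<^sup>2)" using \<mu>_pos by simp
  ultimately have "\<forall>\<^sub>F q in nhds p. \<mu> ((norm q)\<^sup>2) < 4 * \<mu> ((norm p)\<^sup>2)"
    by (rule order_tendstoD)
  then show ?thesis
  proof eventually_elim
    case (elim q)
    have "\<mu> ((norm q)\<^sup>2) \<le> 4 * \<mu> ((max (norm p) (norm q))\<^sup>2)"
      using elim \<mu>_pos[of "(norm q)\<^sup>2"] by (auto simp: max_def)
    then have "(r - 1) / 8 * \<mu> ((norm q)\<^sup>2) * (norm (p - q))\<^sup>2
        \<le> (r - 1) / 8 * (4 * \<mu> ((max (norm p) (norm q))\<^sup>2)) * (norm (p - q))\<^sup>2"
      using r by (intro mult_right_mono mult_left_mono) auto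
    also have "\<dots> \<le> bregman q p"
      using bregman_lower[of p q] by simp
    finally show ?case .
  qed
qed

text \<open>A point \<open>q\<close> near \<open>p\<close> with norm outside the middle range forces
  \<open>p\<close> onto the same closed plateau, even if \<open>p\<close> sits on a kink; there the
  distance is exactly quadratic.\<close>

lemma eventually_bregman_lower_outside:
  fixes p :: "'a::real_inner"
  shows "\<forall>\<^sub>F q in nhds p. norm q \<notin> {em..ep} \<longrightarrow>
    1 / 8 * \<mu> ((norm q)\<^sup>2) * (norm (p - q))\<^sup>2 \<le> bregman q p"
proof -
  have lim: "(norm \<longlongrightarrow> norm p) (nhds p)"
    by (intro tendsto_intros filterlim_ident)
  have "\<forall>\<^sub>F q in nhds p. norm p > em \<longrightarrow> norm q > em"
    using order_tendstoD(1)[OF lim, of em] by (cases "norm p > em") auto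
  moreover have "\<forall>\<^sub>F q in nhds p. norm p < ep \<longrightarrow> norm q < ep"
    using order_tendstoD(2)[OF lim, of ep] by (cases "norm p < ep") auto
  ultimately show ?thesis
  proof eventually_elim
    case (elim q)
    show ?case
    proof
      assume "norm q \<notin> {em..ep}"
      then have "bregman q p = (1/2) * \<mu> ((norm q)\<^sup>2) * (norm (p - q))\<^sup>2"
        using elim eps by (intro bregman_affine) auto
      moreover have "0 \<le> \<mu> ((norm q)\<^sup>2) * (norm (p - q))\<^sup>2"
        using \<mu>_pos[of "(norm q)\<^sup>2"] by simp
      ultimately show "1 / 8 * \<mu> ((norm q)\<^sup>2) * (norm (p - q))\<^sup>2 \<le> bregman q p"
        by linarith
    qed
  qed
qed

end

section \<open>The value of the essential supremum in \<open>q_A\<close>\<close>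

lemma esssup_eqI:
  fixes c :: ereal
  assumes "g \<in> borel_measurable M" "AE x in M. g x \<le> c" "\<not> (AE x in M. g x < c)"
  shows "esssup M g = c"
proof (rule antisym)
  show "esssup M g \<le> c" by (rule esssup_I) (use assms in auto)
  show "c \<le> esssup M g"
  proof (rule ccontr)
    assume "\<not> c \<le> esssup M g"
    then have "AE x in M. g x < c" using esssup_AE[of g M] by (auto elim: eventually_mono)
    then show False using assms by simp
  qed
qed

context viscosity begin

lemma deriv_\<mu>:
  "t < em\<^sup>2 \<Longrightarrow> deriv \<mu> t = 0"
  "ep\<^sup>2 < t \<Longrightarrow> deriv \<mu> t = 0"
  "em\<^sup>2 < t \<Longrightarrow> t < ep\<^sup>2 \<Longrightarrow> deriv \<mu> t = (r - 2) / 2 * t powr ((r - 2) / 2 - 1)"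
proof -
  show "deriv \<mu> t = 0" if "t < em\<^sup>2"
  proof (rule DERIV_imp_deriv, rule has_field_derivative_transform_within_open)
    show "((\<lambda>_. em powr (r - 2)) has_real_derivative 0) (at t)" by simp
    show "open {..<em\<^sup>2}" "t \<in> {..<em\<^sup>2}" using that by auto
  qed (simp add: mu_eps_def)
  show "deriv \<mu> t = 0" if "ep\<^sup>2 < t"
  proof (rule DERIV_imp_deriv, rule has_field_derivative_transform_within_open)
    show "((\<lambda>_. ep powr (r - 2)) has_real_derivative 0) (at t)" by simp
    show "open {ep\<^sup>2<..}" "t \<in> {ep\<^sup>2<..}" using that by auto
  qed (use eps_sq in \<open>auto simp: mu_eps_def\<close>)
  show "deriv \<mu> t = (r - 2) / 2 * t powr ((r - 2) / 2 - 1)" if "em\<^sup>2 < t" "t < ep\<^sup>2"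
  proof (rule DERIV_imp_deriv, rule has_field_derivative_transform_within_open)
    have "0 < t" using that eps_sq by linarith
    then show "((\<lambda>t. t powr ((r - 2) / 2)) has_real_derivative (r - 2) / 2 * t powr ((r - 2) / 2 - 1)) (at t)"
      by (rule has_real_derivative_powr)
    show "open {em\<^sup>2<..<ep\<^sup>2}" "t \<in> {em\<^sup>2<..<ep\<^sup>2}" using that by auto
  qed (auto simp: mu_eps_def)
qed

text \<open>The quotient inside \<open>q_A\<close>. With \<open>t = s^2\<close> the denominator is
  the derivative in \<open>s\<close> of the stress \<open>\<mu>(s^2) s\<close>.\<close>

definition contrast :: "real \<Rightarrow> real" where
  "contrast t = \<mu> t / (2 * deriv \<mu> t * t + \<mu> t)"

lemma contrast_outside: "t < em\<^sup>2 \<or> ep\<^sup>2 < t \<Longrightarrow> contrast t = 1"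
  using \<mu>_pos[of t] deriv_\<mu>(1,2)[of t] by (auto simp: contrast_def)

lemma contrast_inside:
  assumes "em\<^sup>2 < t" "t < ep\<^sup>2"
  shows "contrast t = 1 / (r - 1)"
proof -
  have t: "0 < t" using assms eps_sq by linarith
  have "\<mu> t = t powr ((r - 2) / 2)" using assms by (simp add: mu_eps_def)
  moreover have "2 * deriv \<mu> t * t = (r - 2) * t powr ((r - 2) / 2)"
    using t deriv_\<mu>(3)[OF assms] by (simp add: powr_diff)
  ultimately have "contrast t = t powr ((r - 2) / 2) / ((r - 1) * t powr ((r - 2) / 2))"
    by (simp add: contrast_def algebra_simps)
  then show ?thesis using t by simp
qed

lemma contrast_measurable [measurable]: "contrast \<in> borel_measurable borel"
proof -
  \<comment> \<open>At the two kinks \<open>deriv\<close> is unspecified; keeping these two values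
    as constants leaves a piecewise constant function.\<close>
  have "contrast = (\<lambda>t. if t = em\<^sup>2 then contrast (em\<^sup>2) else if t = ep\<^sup>2 then contrast (ep\<^sup>2)
      else if em\<^sup>2 < t \<and> t < ep\<^sup>2 then 1 / (r - 1) else 1)"
    using contrast_outside contrast_inside by (auto simp: fun_eq_iff not_less less_le)
  also have "\<dots> \<in> borel_measurable borel" by measurable
  finally show ?thesis .
qed

text \<open>Off the kinks the quotient is 1 or the larger \<open>1 / (r - 1)\<close>, so the
  essential supremum depends only on whether \<open>I\<close> is null. The null case also records
  that the strain norm avoids the middle range, which the bound with constant 1 requires.\<close>

lemma q_A_dichotomy:
  fixes \<Omega> :: "(real^'d::finite) set"
  assumes \<Omega>: "open \<Omega>" "\<Omega> \<noteq> {}" and e: "strain \<Omega> w \<in> L2 \<Omega>"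
    and null: "{x \<in> \<Omega>. norm (strain \<Omega> w x) \<in> {em, ep}} \<in> null_sets lebesgue"
  defines "I \<equiv> {x \<in> \<Omega>. em \<le> norm (strain \<Omega> w x) \<and> norm (strain \<Omega> w x) \<le> ep}"
  shows "emeasure lebesgue I > 0 \<Longrightarrow> q_A \<Omega> r em ep w = 1 - (1/4) * (r - 1)"
    and "\<not> emeasure lebesgue I > 0 \<Longrightarrow> q_A \<Omega> r em ep w = 1 - (1/4) * 1 \<and>
      (AE x in lebesgue_on \<Omega>. norm (strain \<Omega> w x) \<notin> {em..ep})"
proof -
  let ?t = "\<lambda>x. (norm (strain \<Omega> w x))\<^sup>2"
  let ?g = "\<lambda>x. ereal (contrast (?t x))"
  note [measurable] = L2_measurable[OF e]
  have \<Omega>m: "\<Omega> \<in> sets lebesgue" using \<Omega> by (simp add: borel_open)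
  have g: "?g \<in> borel_measurable (lebesgue_on \<Omega>)" by measurable
  have q: "q_A \<Omega> r em ep w = 1 - (1/4) * inverse (real_of_ereal (esssup (lebesgue_on \<Omega>) ?g))"
    by (simp add: q_A_def contrast_def Let_def)
  have kink: "AE x in lebesgue_on \<Omega>. norm (strain \<Omega> w x) \<noteq> em \<and> norm (strain \<Omega> w x) \<noteq> ep"
  proof -
    have "AE x in lebesgue. x \<notin> {x \<in> \<Omega>. norm (strain \<Omega> w x) \<in> {em, ep}}"
      using null by (rule AE_not_in)
    then show ?thesis using \<Omega>m by (auto simp: AE_restrict_space_iff elim: eventually_mono)
  qed
  have Im: "I \<in> sets lebesgue"
  proof -
    have "I = {x \<in> space (lebesgue_on \<Omega>). em \<le> norm (strain \<Omega> w x) \<and> norm (strain \<Omega> w x) \<le> ep}"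
      by (auto simp: I_def)
    also have "\<dots> \<in> sets (lebesgue_on \<Omega>)" by measurable
    finally show ?thesis using \<Omega>m by (simp add: sets_restrict_space_iff)
  qed
  have sq: "(norm y)\<^sup>2 < em\<^sup>2 \<longleftrightarrow> norm y < em" "ep\<^sup>2 < (norm y)\<^sup>2 \<longleftrightarrow> ep < norm y"
    "em\<^sup>2 < (norm y)\<^sup>2 \<longleftrightarrow> em < norm y" "(norm y)\<^sup>2 < ep\<^sup>2 \<longleftrightarrow> norm y < ep" for y :: "real^'d^'d"
    using eps by (simp_all add: not_le[symmetric])
  have r1: "1 < 1 / (r - 1)" using r by simp
  show "q_A \<Omega> r em ep w = 1 - (1/4) * (r - 1)" if "emeasure lebesgue I > 0"
  proof -
    have "esssup (lebesgue_on \<Omega>) ?g = ereal (1 / (r - 1))"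
    proof (rule esssup_eqI[OF g])
      show "AE x in lebesgue_on \<Omega>. ?g x \<le> ereal (1 / (r - 1))"
        using kink
      proof eventually_elim
        case (elim x)
        then consider "norm (strain \<Omega> w x) < em" | "ep < norm (strain \<Omega> w x)"
          | "em < norm (strain \<Omega> w x)" "norm (strain \<Omega> w x) < ep" by linarith
        then show ?case
          using contrast_outside[of "?t x"] contrast_inside[of "?t x"] r1 by cases (auto simp: sq)
      qed
      show "\<not> (AE x in lebesgue_on \<Omega>. ?g x < ereal (1 / (r - 1)))"
      proof
        assume "AE x in lebesgue_on \<Omega>. ?g x < ereal (1 / (r - 1))"
        with kink have "AE x in lebesgue_on \<Omega>. x \<notin> I"
        proof eventually_elim
          case (elim x)
          then show ?case using contrast_inside[of "?t x"] by (auto simp: sq I_def)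
        qed
        then have "AE x in lebesgue. x \<notin> I"
          using \<Omega>m by (auto simp: AE_restrict_space_iff I_def elim: eventually_mono)
        then have "emeasure lebesgue I = 0"
          using Im by (simp add: AE_iff_measurable[OF Im])
        then show False using that by simp
      qed
    qed
    then show ?thesis unfolding q using r by simp
  qed
  show "q_A \<Omega> r em ep w = 1 - (1/4) * 1 \<and> (AE x in lebesgue_on \<Omega>. norm (strain \<Omega> w x) \<notin> {em..ep})"
    if "\<not> emeasure lebesgue I > 0"
  proof
    have "I \<in> null_sets lebesgue" using that Im by (simp add: null_setsI)
    then have "AE x in lebesgue. x \<notin> I" by (rule AE_not_in)
    then show out: "AE x in lebesgue_on \<Omega>. norm (strain \<Omega> w x) \<notin> {em..ep}"
      using \<Omega>m by (auto simp: AE_restrict_space_iff I_def elim: eventually_mono)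
    then have one: "AE x in lebesgue_on \<Omega>. ?g x = 1"
    proof eventually_elim
      case (elim x)
      then show ?case using contrast_outside[of "?t x"] by (auto simp: sq not_le)
    qed
    have "esssup (lebesgue_on \<Omega>) ?g = 1"
    proof (rule esssup_eqI[OF g])
      show "AE x in lebesgue_on \<Omega>. ?g x \<le> 1" using one by eventually_elim simp
      \<comment> \<open>The quotient is 1 almost everywhere, so a strict bound would make the domain
        a null set, while a nonempty open set has positive measure.\<close>
      show "\<not> (AE x in lebesgue_on \<Omega>. ?g x < 1)"
      proof
        assume "AE x in lebesgue_on \<Omega>. ?g x < 1"
        with one have "AE x in lebesgue_on \<Omega>. False" by eventually_elim simp
        then have "AE x in lebesgue. x \<notin> \<Omega>" using \<Omega>m by (simp add: AE_restrict_space_iff)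
        then have "emeasure lebesgue \<Omega> = 0" using \<Omega>m by (simp add: AE_iff_measurable[OF \<Omega>m])
        then have "negligible \<Omega>" using \<Omega>m by (simp add: negligible_iff_null_sets null_setsI)
        then show False using open_not_negligible[OF \<Omega>] by simp
      qed
    qed
    then show "q_A \<Omega> r em ep w = 1 - (1/4) * 1" unfolding q by simp
  qed
qed

end

subsection \<open>The Kacanov iteration\<close>

lemma norm_diff_scaleR_square:
  "(norm (a - c *\<^sub>R b))\<^sup>2 = (norm a)\<^sup>2 - 2 * c * (a \<bullet> b) + c\<^sup>2 * (norm b)\<^sup>2"
proof -
  have "(a - c *\<^sub>R b) \<bullet> (a - c *\<^sub>R b) = a \<bullet> a - 2 * c * (a \<bullet> b) + c\<^sup>2 * (b \<bullet> b)"
    by (simp only: inner_diff_left inner_diff_right inner_scaleR_left inner_scaleR_right inner_commute[of b a])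
       algebra
  then show ?thesis by (simp only: power2_norm_eq_inner)
qed

context viscosity begin

lemma \<mu>_measurable [measurable]: "\<mu> \<in> borel_measurable borel"
  by (intro borel_measurable_continuous_onI continuous_\<mu>)

lemma \<phi>_measurable [measurable]: "\<phi> \<in> borel_measurable borel"
proof (intro borel_measurable_continuous_onI continuous_at_imp_continuous_on ballI)
  fix s :: real
  \<comment> \<open>For negative arguments the integral runs over an empty interval, so continuity
    on \<open>{0..R}\<close> extends to the whole line.\<close>
  have "\<phi> t = \<phi> (max 0 t)" for t by (simp add: phi_eps_def max_def)
  then have eq: "\<phi> = (\<lambda>t. \<phi> (max 0 t))" by auto
  have "continuous_on {..<\<bar>s\<bar> + 1} (\<lambda>t. \<phi> (max 0 t))"
    by (rule continuous_on_compose2[OF continuous_\<phi>[of "\<bar>s\<bar> + 1"]]) (auto intro!: continuous_intros)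
  then have "continuous_on {..<\<bar>s\<bar> + 1} \<phi>" by (subst eq)
  moreover have "s \<in> {..<\<bar>s\<bar> + 1}" using abs_ge_self[of s] unfolding lessThan_iff by linarith
  ultimately show "isCont \<phi> s" by (simp only: continuous_on_eq_continuous_at[OF open_lessThan])
qed

text \<open>Concavity of \<open>\<phi>\<close>, a consequence of the monotonicity of
  \<open>\<mu>\<close>; with \<open>p\<close> the strain of the next iterate it yields the energy
  decrease.\<close>

lemma bregman_upper: "bregman q p \<le> (1/2) * \<mu> ((norm q)\<^sup>2) * (norm (p - q))\<^sup>2"
proof -
  have s: "(norm (p - q))\<^sup>2 = (norm p)\<^sup>2 - 2 * (q \<bullet> p) + (norm q)\<^sup>2"
    by (simp add: power2_norm_eq_inner algebra_simps inner_commute)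
  show ?thesis
    using \<phi>_concave[of "(norm p)\<^sup>2" "(norm q)\<^sup>2"] unfolding bregman_def s
    by (simp add: inner_diff_right power2_norm_eq_inner[symmetric] field_simps)
qed

end

locale kacanov = viscosity +
  fixes \<Omega> :: "(real^'d::finite) set" and f :: "real^'d \<Rightarrow> real^'d" and W and u and ustar
  assumes \<Omega>: "open \<Omega>" "bounded \<Omega>" "\<Omega> \<noteq> {}" and f: "f \<in> L2 \<Omega>"
    and W: "fin_dim_subspace_V \<Omega> W"
    and minimiser: "is_arg_min (energy \<Omega> f r em ep) (\<lambda>v. v \<in> W) ustar"
    and iteration: "kacanov_sequence \<Omega> f r em ep W u"
begin

abbreviation "M \<equiv> lebesgue_on \<Omega>"
abbreviation "E \<equiv> energy \<Omega> f r em ep"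
abbreviation "strn \<equiv> strain \<Omega>"

definition "weight n x = \<mu> ((norm (strn (u n) x))\<^sup>2)"
definition "step n x = strn (u (Suc n)) x - strn (u n) x"
definition "err n x = strn ustar x - strn (u n) x"

lemma u_W: "u n \<in> W"
  using iteration by (cases n) (auto simp: kacanov_sequence_def)

lemma ustar_W: "ustar \<in> W"
  using minimiser by (simp add: is_arg_min_def)

lemma E_ge: "v \<in> W \<Longrightarrow> E ustar \<le> E v"
  using minimiser by (auto simp: is_arg_min_def not_less)

lemma W_V: "w \<in> W \<Longrightarrow> w \<in> V_space \<Omega>"
  using W by (auto simp: fin_dim_subspace_V_def)

lemma W_diff:
  assumes "v \<in> W" "w \<in> W"
  shows "(\<lambda>x. v x - w x) \<in> W"
proof -
  have add: "\<forall>v\<in>W. \<forall>w\<in>W. (\<lambda>x. v x + w x) \<in> W" and scale: "\<forall>c. \<forall>w\<in>W. (\<lambda>x. c *\<^sub>R w x) \<in> W"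
    using W by (simp_all add: fin_dim_subspace_V_def)
  show ?thesis
    using add[rule_format, OF assms(1) scale[rule_format, OF assms(2), of "- 1"]] by simp
qed

lemma strain_diff:
  assumes "v \<in> W" "w \<in> W"
  shows "AE x in M. strn (\<lambda>x. v x - w x) x = strn v x - strn w x"
proof -
  \<comment> \<open>Indexing by \<open>bool\<close> instead of the set \<open>{v, w}\<close> keeps
    two terms even when \<open>v = w\<close>.\<close>
  have "AE x in M. strn (\<lambda>x. v x - w x) x
      = (\<Sum>i\<in>UNIV. (if i then 1 else - 1) *\<^sub>R strn (if i then v else w) x)"
  proof (rule strain_sum[OF \<Omega>(1,2)])
    show "(if i then v else w) \<in> V_space \<Omega>" for i using assms W_V by simp
    show "(\<lambda>x. v x - w x) \<in> V_space \<Omega>" by (intro W_V W_diff assms)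
    show "AE x in M. v x - w x = (\<Sum>i\<in>UNIV. (if i then 1 else - 1) *\<^sub>R (if i then v else w) x)"
      by (simp add: UNIV_bool)
  qed simp
  then show ?thesis by eventually_elim (simp add: UNIV_bool)
qed

lemma strn_L2: "w \<in> W \<Longrightarrow> strn w \<in> L2 \<Omega>"
  by (intro strain_L2 \<Omega> W_V)

lemma strn_measurable [measurable]: "strn (u n) \<in> borel_measurable M" "strn ustar \<in> borel_measurable M"
  by (intro L2_measurable strn_L2 u_W ustar_W)+

lemma step_L2: "step n \<in> L2 \<Omega>"
  unfolding step_def[abs_def] by (intro L2_diff strn_L2 u_W)

lemma err_L2: "err n \<in> L2 \<Omega>"
  unfolding err_def[abs_def] by (intro L2_diff strn_L2 u_W ustar_W)

lemma weight_measurable [measurable]: "weight n \<in> borel_measurable M"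
  unfolding weight_def[abs_def] by measurable

lemma weight_bounds: "0 < weight n x" "ep powr (r - 2) \<le> weight n x" "weight n x \<le> em powr (r - 2)"
  "\<bar>weight n x\<bar> \<le> em powr (r - 2)"
  using \<mu>_pos \<mu>_ge \<mu>_le by (auto simp: weight_def abs_of_pos)

lemma integrable_weight_inner:
  "g \<in> L2 \<Omega> \<Longrightarrow> h \<in> L2 \<Omega> \<Longrightarrow> integrable M (\<lambda>x. weight n x * (g x \<bullet> h x))"
  by (rule integrable_weighted_inner[OF _ _ weight_measurable weight_bounds(4)])

lemma W_L2: "w \<in> W \<Longrightarrow> w \<in> L2 \<Omega>"
proof (rule L2_vecI[OF \<Omega>(1,2)])
  fix i assume "w \<in> W"
  then have "(\<lambda>x. w x $ i) \<in> H1 \<Omega>" using W_V by (simp add: V_space_def H10_def)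
  then show "(\<lambda>x. w x $ i) \<in> L2 \<Omega>"
    using H1_has_weak_gradient[OF \<Omega>(1,2)] by (simp add: has_weak_gradient_def)
qed

lemma integrable_\<phi>:
  assumes "w \<in> W"
  shows "integrable M (\<lambda>x. \<phi> ((norm (strn w x))\<^sup>2))"
proof (rule Bochner_Integration.integrable_bound)
  note [measurable] = L2_measurable[OF strn_L2[OF assms]]
  show "(\<lambda>x. \<phi> ((norm (strn w x))\<^sup>2)) \<in> borel_measurable M" by measurable
  show "integrable M (\<lambda>x. (1/2) * em powr (r - 2) * (norm (strn w x))\<^sup>2)"
    using L2_integrable_norm_square[OF strn_L2[OF assms]] by (rule integrable_mult_right)
  show "AE x in M. norm (\<phi> ((norm (strn w x))\<^sup>2)) \<le> norm ((1/2) * em powr (r - 2) * (norm (strn w x))\<^sup>2)"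
  proof (rule AE_I2)
    fix x
    show "norm (\<phi> ((norm (strn w x))\<^sup>2)) \<le> norm ((1/2) * em powr (r - 2) * (norm (strn w x))\<^sup>2)"
      using \<phi>_bounds[of "(norm (strn w x))\<^sup>2"] by (simp add: abs_of_nonneg)
  qed
qed

section \<open>Energy differences and convergence of the iteration\<close>

lemma integrable_bregman:
  assumes "v \<in> W"
  shows "integrable M (\<lambda>x. bregman (strn (u n) x) (strn v x))"
proof -
  have "integrable M (\<lambda>x. weight n x * (strn (u n) x \<bullet> (strn v x - strn (u n) x)))"
    by (intro integrable_weight_inner L2_diff strn_L2 u_W assms)
  then show ?thesis
    unfolding bregman_def weight_def
    by (intro Bochner_Integration.integrable_diff integrable_\<phi> u_W assms)
qed

text \<open>The iteration equation tested with \<open>v - u n\<close> expresses the work of the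
  force through the strain of \<open>u (Suc n)\<close>. Writing this strain as \<open>step n\<close>
  plus the strain of \<open>u n\<close>, the second part is the first-order term of the Bregman
  distance.\<close>

lemma energy_diff:
  assumes v: "v \<in> W"
  shows "E v - E (u n) = (LINT x|M. bregman (strn (u n) x) (strn v x))
    - (LINT x|M. weight n x * (step n x \<bullet> (strn v x - strn (u n) x)))"
proof -
  let ?d = "\<lambda>x. strn v x - strn (u n) x"
  let ?S = "\<lambda>w. LINT x|M. \<phi> ((norm (strn w x))\<^sup>2)"
  have d: "?d \<in> L2 \<Omega>" by (intro L2_diff strn_L2 u_W v)
  have "(LINT x|M. f x \<bullet> v x) - (LINT x|M. f x \<bullet> u n x) = (LINT x|M. f x \<bullet> (v x - u n x))"
    using integrable_inner[OF f W_L2[OF v]] integrable_inner[OF f W_L2[OF u_W[of n]]]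
    by (simp add: inner_diff_right)
  also have "\<dots> = (LINT x|M. weight n x * (strn (u (Suc n)) x \<bullet> strn (\<lambda>x. v x - u n x) x))"
    using iteration W_diff[OF v u_W] by (auto simp: kacanov_sequence_def weight_def)
  also have "\<dots> = (LINT x|M. weight n x * (strn (u (Suc n)) x \<bullet> ?d x))"
  proof (rule integral_cong_AE)
    note [measurable] = L2_measurable[OF strn_L2[OF v]] L2_measurable[OF strn_L2[OF W_diff[OF v u_W[of n]]]]
    show "(\<lambda>x. weight n x * (strn (u (Suc n)) x \<bullet> strn (\<lambda>x. v x - u n x) x)) \<in> borel_measurable M"
      "(\<lambda>x. weight n x * (strn (u (Suc n)) x \<bullet> ?d x)) \<in> borel_measurable M" by measurable
    show "AE x in M. weight n x * (strn (u (Suc n)) x \<bullet> strn (\<lambda>x. v x - u n x) x)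
        = weight n x * (strn (u (Suc n)) x \<bullet> ?d x)"
      using strain_diff[OF v u_W[of n]] by eventually_elim simp
  qed
  also have "\<dots> = (LINT x|M. weight n x * (step n x \<bullet> ?d x) + weight n x * (strn (u n) x \<bullet> ?d x))"
    by (simp add: step_def inner_diff_left algebra_simps)
  also have "\<dots> = (LINT x|M. weight n x * (step n x \<bullet> ?d x)) + (LINT x|M. weight n x * (strn (u n) x \<bullet> ?d x))"
    by (intro Bochner_Integration.integral_add integrable_weight_inner d step_L2 strn_L2 u_W)
  finally have l: "(LINT x|M. f x \<bullet> v x) - (LINT x|M. f x \<bullet> u n x)
    = (LINT x|M. weight n x * (step n x \<bullet> ?d x)) + (LINT x|M. weight n x * (strn (u n) x \<bullet> ?d x))" .
  have "(LINT x|M. bregman (strn (u n) x) (strn v x))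
      = ?S v - ?S (u n) - (LINT x|M. weight n x * (strn (u n) x \<bullet> ?d x))"
    unfolding bregman_def weight_def[symmetric]
    using integrable_\<phi>[OF v] integrable_\<phi>[OF u_W[of n]] integrable_weight_inner[OF strn_L2[OF u_W[of n]] d, of n]
    by (subst Bochner_Integration.integral_diff) (auto simp: Bochner_Integration.integral_diff)
  with l show ?thesis unfolding energy_def by simp
qed

lemma integrable_weight_square: "g \<in> L2 \<Omega> \<Longrightarrow> integrable M (\<lambda>x. weight n x * (norm (g x))\<^sup>2)"
  by (rule integrable_weighted_square[OF _ weight_measurable weight_bounds(4)])

text \<open>Take \<open>v = u (Suc n)\<close> in \<open>energy_diff\<close>: the mixed term is the
  full weighted square of the step, and \<open>bregman_upper\<close> gives back at most half of
  it.\<close>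

lemma descent: "E (u (Suc n)) - E (u n) \<le> - (1/2) * (LINT x|M. weight n x * (norm (step n x))\<^sup>2)"
proof -
  have "(LINT x|M. bregman (strn (u n) x) (strn (u (Suc n)) x))
      \<le> (LINT x|M. (1/2) * (weight n x * (norm (step n x))\<^sup>2))"
    using bregman_upper[of "strn (u n) x" "strn (u (Suc n)) x" for x]
    by (intro integral_mono integrable_bregman u_W integrable_mult_right integrable_weight_square step_L2)
       (simp add: weight_def step_def)
  moreover have "(LINT x|M. weight n x * (step n x \<bullet> (strn (u (Suc n)) x - strn (u n) x)))
      = (LINT x|M. weight n x * (norm (step n x))\<^sup>2)"
    by (simp add: step_def[symmetric] power2_norm_eq_inner)
  ultimately show ?thesis
    using energy_diff[OF u_W[of "Suc n"], of n] by simp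
qed

lemma gap: "E ustar - E (u n) = (LINT x|M. bregman (strn (u n) x) (strn ustar x))
    - (LINT x|M. weight n x * (step n x \<bullet> err n x))"
  using energy_diff[OF ustar_W, of n] by (simp add: err_def)

lemma V_norm_err: "(V_norm \<Omega> (\<lambda>x. ustar x - u n x))\<^sup>2 = (LINT x|M. (norm (err n x))\<^sup>2)"
proof -
  let ?s = "strn (\<lambda>x. ustar x - u n x)"
  have "V_inner \<Omega> (\<lambda>x. ustar x - u n x) (\<lambda>x. ustar x - u n x) = (LINT x|M. (norm (err n x))\<^sup>2)"
    unfolding V_inner_def
  proof (rule integral_cong_AE)
    note [measurable] = L2_measurable[OF strn_L2[OF W_diff[OF ustar_W u_W[of n]]]] L2_measurable[OF err_L2]
    show "(\<lambda>x. ?s x \<bullet> ?s x) \<in> borel_measurable M" "(\<lambda>x. (norm (err n x))\<^sup>2) \<in> borel_measurable M"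
      by measurable
    show "AE x in M. ?s x \<bullet> ?s x = (norm (err n x))\<^sup>2"
      using strain_diff[OF ustar_W u_W[of n]] by eventually_elim (simp add: err_def power2_norm_eq_inner)
  qed
  moreover have "0 \<le> (LINT x|M. (norm (err n x))\<^sup>2)" by (rule integral_nonneg_AE) simp
  ultimately show ?thesis by (simp add: V_norm_def)
qed

text \<open>All errors are combinations of the strains of one finite spanning set, so a single
  \<open>G\<close> serves every \<open>n\<close>. This is where the finite dimension of
  \<open>W\<close> enters.\<close>

lemma err_pointwise_bound:
  "\<exists>G. integrable M G \<and> (\<forall>x. 0 \<le> G x) \<and>
    (\<forall>n. AE x in M. (norm (err n x))\<^sup>2 \<le> (LINT y|M. (norm (err n y))\<^sup>2) * G x)"
proof -
  obtain B where B: "finite B" "B \<subseteq> W" "\<And>w. w \<in> W \<Longrightarrow> \<exists>c. AE x in M. w x = (\<Sum>b\<in>B. c b *\<^sub>R b x)"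
    using W unfolding fin_dim_subspace_V_def by blast
  have L: "strn b \<in> L2 \<Omega>" if "b \<in> B" for b using B(2) strn_L2 that by auto
  obtain G where G: "integrable M G" "\<And>x. 0 \<le> G x"
    and bound: "\<And>c. AE x in M. (norm (\<Sum>b\<in>B. c b *\<^sub>R strn b x))\<^sup>2
        \<le> (LINT y|M. (norm (\<Sum>b\<in>B. c b *\<^sub>R strn b y))\<^sup>2) * G x"
    using L2_combination_pointwise_bound[of B strn \<Omega>, OF B(1) L] by auto
  have "AE x in M. (norm (err n x))\<^sup>2 \<le> (LINT y|M. (norm (err n y))\<^sup>2) * G x" for n
  proof -
    have w: "(\<lambda>x. ustar x - u n x) \<in> W" by (intro W_diff ustar_W u_W)
    obtain c where c: "AE x in M. ustar x - u n x = (\<Sum>b\<in>B. c b *\<^sub>R b x)"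
      using B(3)[OF w] by auto
    have "AE x in M. strn (\<lambda>x. ustar x - u n x) x = (\<Sum>b\<in>B. c b *\<^sub>R strn b x)"
      using B(2) by (intro strain_sum \<Omega> B(1) c W_V w) auto
    with strain_diff[OF ustar_W u_W[of n]]
    have eq: "AE x in M. err n x = (\<Sum>b\<in>B. c b *\<^sub>R strn b x)"
      by eventually_elim (simp add: err_def)
    have L: "(\<lambda>x. \<Sum>b\<in>B. c b *\<^sub>R strn b x) \<in> L2 \<Omega>"
      using B strn_L2 by (intro L2_sum) auto
    have "(LINT y|M. (norm (err n y))\<^sup>2) = (LINT y|M. (norm (\<Sum>b\<in>B. c b *\<^sub>R strn b y))\<^sup>2)"
      using eq L2_integrable_norm_square[OF err_L2] L2_integrable_norm_square[OF L]
      by (intro integral_cong_AE) (auto elim: eventually_mono)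
    with eq bound[of c] show ?thesis by (auto elim: eventually_elim2)
  qed
  with G show ?thesis by (intro exI[of _ G] conjI allI)
qed

text \<open>The energies decrease and are bounded below by the minimum, so their decrements tend to
  0. A decrement controls the step by \<open>descent\<close>, and the step controls the error by
  \<open>gap\<close> and the strong convexity in \<open>bregman_strong\<close>.\<close>

lemma err_tendsto_0: "(\<lambda>n. LINT x|M. (norm (err n x))\<^sup>2) \<longlonglongrightarrow> 0"
proof -
  define m C c where "m = (r - 1) * ep powr (r - 2)" and "C = em powr (r - 2)" and "c = ep powr (r - 2)"
  have pos: "0 < m" "0 < C" "0 < c" using r eps by (auto simp: m_def C_def c_def)
  let ?D = "\<lambda>n. LINT x|M. (norm (step n x))\<^sup>2" and ?S = "\<lambda>n. LINT x|M. (norm (err n x))\<^sup>2"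
  have step: "?D n \<le> 2 / c * (E (u n) - E (u (Suc n)))" for n
  proof -
    have "c * ?D n = (LINT x|M. c * (norm (step n x))\<^sup>2)" by simp
    also have "\<dots> \<le> (LINT x|M. weight n x * (norm (step n x))\<^sup>2)"
      using weight_bounds(2) unfolding c_def
      by (intro integral_mono integrable_mult_right integrable_weight_square step_L2
          L2_integrable_norm_square mult_right_mono) auto
    also have "\<dots> \<le> 2 * (E (u n) - E (u (Suc n)))" using descent[of n] by simp
    finally show ?thesis using pos by (simp add: field_simps)
  qed
  have err: "?S n \<le> 4 / m * (C\<^sup>2 / m * (2 / c * (E (u n) - E (u (Suc n)))))" for n
  proof -
    have b1: "(LINT x|M. (1/2) * m * (norm (err n x))\<^sup>2) \<le> (LINT x|M. bregman (strn (u n) x) (strn ustar x))"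
      using bregman_strong[of "strn ustar x" "strn (u n) x" for x] unfolding m_def err_def
      by (intro integral_mono integrable_bregman ustar_W integrable_mult_right
          L2_integrable_norm_square[OF err_L2[unfolded err_def[abs_def]]])
    \<comment> \<open>Minimality makes the left side of \<open>gap\<close> nonpositive.\<close>
    have b2: "(LINT x|M. bregman (strn (u n) x) (strn ustar x)) \<le> (LINT x|M. weight n x * (step n x \<bullet> err n x))"
      using gap[of n] E_ge[OF u_W[of n]] by simp
    \<comment> \<open>Young's inequality with weight \<open>m / 4\<close>, so that half of the
      coercivity constant \<open>m / 2\<close> from \<open>b1\<close> survives absorption.\<close>
    have b3: "(LINT x|M. weight n x * (step n x \<bullet> err n x))
        \<le> (LINT x|M. (1/4) * m * (norm (err n x))\<^sup>2 + C\<^sup>2 / m * (norm (step n x))\<^sup>2)"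
    proof (intro integral_mono integrable_weight_inner Bochner_Integration.integrable_add
        integrable_mult_right L2_integrable_norm_square err_L2 step_L2)
      fix x
      let ?a = "norm (err n x)" and ?b = "norm (step n x)"
      have "weight n x * (step n x \<bullet> err n x) \<le> C * (?b * ?a)"
      proof -
        have "weight n x * (step n x \<bullet> err n x) \<le> weight n x * (?b * ?a)"
          using weight_bounds(1)[of n x] norm_cauchy_schwarz by (intro mult_left_mono) auto
        also have "\<dots> \<le> C * (?b * ?a)"
          using weight_bounds(3)[of n x] unfolding C_def by (intro mult_right_mono) auto
        finally show ?thesis .
      qed
      also have "\<dots> \<le> (1/4) * m * ?a\<^sup>2 + C\<^sup>2 / m * ?b\<^sup>2"
      proof -
        have "0 \<le> (m / 2 * ?a - C * ?b)\<^sup>2 / m" using pos by simp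
        also have "\<dots> = (1/4) * m * ?a\<^sup>2 + C\<^sup>2 / m * ?b\<^sup>2 - C * (?b * ?a)"
          using pos by (simp add: power2_diff power_mult_distrib field_simps power2_eq_square)
        finally show ?thesis by simp
      qed
      finally show "weight n x * (step n x \<bullet> err n x) \<le> (1/4) * m * ?a\<^sup>2 + C\<^sup>2 / m * ?b\<^sup>2" .
    qed
    have b4: "(LINT x|M. (1/4) * m * (norm (err n x))\<^sup>2 + C\<^sup>2 / m * (norm (step n x))\<^sup>2)
        = (LINT x|M. (1/4) * m * (norm (err n x))\<^sup>2) + (LINT x|M. C\<^sup>2 / m * (norm (step n x))\<^sup>2)"
      by (intro Bochner_Integration.integral_add integrable_mult_right L2_integrable_norm_square err_L2 step_L2)
    have "(1/2) * m * ?S n \<le> (1/4) * m * ?S n + C\<^sup>2 / m * ?D n"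
      using order_trans[OF order_trans[OF b1 b2] b3] unfolding b4 integral_mult_right_zero .
    then have "m * ?S n \<le> 4 * (C\<^sup>2 / m * ?D n)" by simp
    then have "?S n \<le> 4 / m * (C\<^sup>2 / m * ?D n)" using pos by (simp add: field_simps)
    also have "\<dots> \<le> 4 / m * (C\<^sup>2 / m * (2 / c * (E (u n) - E (u (Suc n)))))"
      using pos by (intro mult_left_mono step) auto
    finally show ?thesis .
  qed
  have "decseq (\<lambda>n. E (u n))"
  proof (rule decseq_SucI)
    fix n
    have "0 \<le> (LINT x|M. weight n x * (norm (step n x))\<^sup>2)"
      using weight_bounds(1) by (intro integral_nonneg_AE AE_I2 mult_nonneg_nonneg) (auto intro: less_imp_le)
    then show "E (u (Suc n)) \<le> E (u n)" using descent[of n] by simp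
  qed
  then obtain L where L: "(\<lambda>n. E (u n)) \<longlonglongrightarrow> L"
    by (rule decseq_convergent[of _ "E ustar"]) (use E_ge[OF u_W] in auto)
  have "(\<lambda>n. E (u n) - E (u (Suc n))) \<longlonglongrightarrow> L - L"
    by (intro tendsto_diff L LIMSEQ_Suc[OF L])
  then have "(\<lambda>n. 4 / m * (C\<^sup>2 / m * (2 / c * (E (u n) - E (u (Suc n)))))) \<longlonglongrightarrow> 4 / m * (C\<^sup>2 / m * (2 / c * (L - L)))"
    by (intro tendsto_mult tendsto_const)
  then have lim: "(\<lambda>n. 4 / m * (C\<^sup>2 / m * (2 / c * (E (u n) - E (u (Suc n)))))) \<longlonglongrightarrow> 0"
    by simp
  have nonneg: "0 \<le> ?S n" for n by (rule integral_nonneg_AE) simp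
  show ?thesis
    by (rule tendsto_sandwich[OF _ _ tendsto_const lim]; intro always_eventually allI nonneg err)
qed

end

section \<open>Contraction of the energy up to a remainder\<close>

context kacanov begin

text \<open>Here \<open>k n\<close> stands for the reciprocal of the essential supremum in
  \<open>q_A\<close>, and \<open>\<rho>\<close> collects the contribution of the points where the
  pointwise Bregman bound still fails.\<close>

lemma energy_contraction:
  fixes k :: "nat \<Rightarrow> real"
  assumes k: "\<And>n. k n = r - 1 \<or> k n = 1 \<and> (AE x in M. norm (strn (u n) x) \<notin> {em..ep})"
  obtains \<rho> where
    "\<And>\<epsilon>. 0 < \<epsilon> \<Longrightarrow> \<exists>N. \<forall>n\<ge>N. \<bar>\<rho> n\<bar> \<le> \<epsilon> * (V_norm \<Omega> (\<lambda>x. ustar x - u n x))\<^sup>2"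
    "\<And>n. E (u (Suc n)) - E ustar \<le> (1 - (1/4) * k n) * (E (u n) - E ustar) + \<rho> n"
proof -
  let ?S = "\<lambda>n. LINT x|M. (norm (err n x))\<^sup>2"
  define C where "C = em powr (r - 2)"
  have k01: "0 < k n" "k n \<le> 1" for n using k[of n] r by auto
  obtain G where G: "integrable M G" "\<And>x. 0 \<le> G x"
    and bound: "\<And>n. AE x in M. (norm (err n x))\<^sup>2 \<le> ?S n * G x"
    using err_pointwise_bound by auto
  have bound_all: "AE x in M. \<forall>n. (norm (err n x))\<^sup>2 \<le> ?S n * G x"
    using bound by (simp add: AE_all_countable)
  note [measurable] = borel_measurable_integrable[OF G(1)] L2_measurable[OF err_L2]
  \<comment> \<open>Almost every point is eventually not \<open>bad\<close>, so \<open>H n\<close>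
    tends to 0 almost everywhere; it is dominated by \<open>G\<close>, hence its integral vanishes
    in the limit.\<close>
  define bad where "bad n x \<longleftrightarrow> bregman (strn (u n) x) (strn ustar x) < k n / 8 * weight n x * (norm (err n x))\<^sup>2" for n x
  define H where "H n x = (if bad n x then G x else 0)" for n x
  have bad_measurable [measurable]: "Measurable.pred M (bad n)" for n
  proof -
    have [measurable]: "(\<lambda>x. bregman (strn (u n) x) (strn ustar x)) \<in> borel_measurable M"
      using integrable_bregman[OF ustar_W] by (rule borel_measurable_integrable)
    show ?thesis unfolding bad_def by measurable
  qed
  have H_measurable [measurable]: "H n \<in> borel_measurable M" for n
    unfolding H_def[abs_def] by measurable
  have H_bound: "0 \<le> H n x" "H n x \<le> G x" for n x using G by (auto simp: H_def)
  have iH: "integrable M (H n)" for n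
    using G(1) H_measurable by (rule Bochner_Integration.integrable_bound) (use H_bound G in auto)
  have pointwise_lim: "AE x in M. (\<lambda>n. strn (u n) x) \<longlonglongrightarrow> strn ustar x"
    using bound_all
  proof eventually_elim
    case (elim x)
    have "(\<lambda>n. ?S n * G x) \<longlonglongrightarrow> 0 * G x"
      by (intro tendsto_mult err_tendsto_0 tendsto_const)
    then have lim: "(\<lambda>n. ?S n * G x) \<longlonglongrightarrow> 0" by simp
    have "(\<lambda>n. (norm (err n x))\<^sup>2) \<longlonglongrightarrow> 0"
      by (rule tendsto_sandwich[OF _ _ tendsto_const lim]) (simp_all add: elim[rule_format])
    then have "(\<lambda>n. sqrt ((norm (err n x))\<^sup>2)) \<longlonglongrightarrow> sqrt 0" by (rule tendsto_real_sqrt)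
    then have "(\<lambda>n. err n x) \<longlonglongrightarrow> 0" by (simp add: tendsto_norm_zero_iff)
    then have "(\<lambda>n. strn ustar x - err n x) \<longlonglongrightarrow> strn ustar x - 0" by (intro tendsto_diff tendsto_const)
    then show ?case by (simp add: err_def)
  qed
  have "AE x in M. \<forall>n. k n \<noteq> r - 1 \<longrightarrow> norm (strn (u n) x) \<notin> {em..ep}"
    unfolding AE_all_countable
  proof
    fix n show "AE x in M. k n \<noteq> r - 1 \<longrightarrow> norm (strn (u n) x) \<notin> {em..ep}"
    proof (cases "k n = r - 1")
      case False
      then have "AE x in M. norm (strn (u n) x) \<notin> {em..ep}" using k[of n] by blast
      then show ?thesis by eventually_elim simp
    qed simp
  qed
  with pointwise_lim have ev_good: "AE x in M. \<forall>\<^sub>F n in sequentially. \<not> bad n x"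
  proof eventually_elim
    case (elim x)
    \<comment> \<open>The value \<open>k n\<close> may change with \<open>n\<close> infinitely
      often, so both eventual bounds are kept and the relevant one is selected for each
      \<open>n\<close>.\<close>
    show ?case
      using filterlim_iff[THEN iffD1, OF elim(1), rule_format, OF eventually_bregman_lower]
        filterlim_iff[THEN iffD1, OF elim(1), rule_format, OF eventually_bregman_lower_outside]
    proof eventually_elim
      case (elim n)
      show ?case
      proof (cases "k n = r - 1")
        case True
        then show ?thesis using elim(1) by (simp add: bad_def weight_def err_def)
      next
        case False
        then have "k n = 1" using k[of n] by auto
        moreover have "norm (strn (u n) x) \<notin> {em..ep}"
          using False \<open>\<forall>n. k n \<noteq> r - 1 \<longrightarrow> norm (strn (u n) x) \<notin> {em..ep}\<close> by blast
        ultimately show ?thesis using elim(2) by (simp add: bad_def weight_def err_def)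
      qed
    qed
  qed
  have "(\<lambda>n. LINT x|M. H n x) \<longlonglongrightarrow> (LINT x|M. 0)"
  proof (rule integral_dominated_convergence[OF _ _ G(1)])
    show "AE x in M. (\<lambda>n. H n x) \<longlonglongrightarrow> 0"
      using ev_good
    proof eventually_elim
      case (elim x)
      then have "\<forall>\<^sub>F n in sequentially. H n x = 0" by eventually_elim (simp add: H_def)
      then show ?case by (rule tendsto_eventually)
    qed
    show "AE x in M. norm (H n x) \<le> G x" for n using H_bound by simp
  qed simp_all
  from tendsto_mult_left[OF this, of C]
  have H_lim: "(\<lambda>n. C * (LINT x|M. H n x)) \<longlonglongrightarrow> 0" by simp
  \<comment> \<open>\<open>C\<close> bounds the weight and \<open>?S n * G x\<close> the squared
    error, so this dominates the integral over the bad points; \<open>?S n\<close> is the squared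
    norm in the remainder estimate.\<close>
  define \<rho> where "\<rho> n = C * (LINT x|M. H n x) * ?S n" for n
  show thesis
  proof
    fix \<epsilon> :: real assume "0 < \<epsilon>"
    then obtain N where N: "\<And>n. n \<ge> N \<Longrightarrow> \<bar>C * (LINT x|M. H n x)\<bar> < \<epsilon>"
      using LIMSEQ_D[OF H_lim, of \<epsilon>] by auto
    have "\<bar>\<rho> n\<bar> \<le> \<epsilon> * (V_norm \<Omega> (\<lambda>x. ustar x - u n x))\<^sup>2" if "n \<ge> N" for n
    proof -
      have "0 \<le> ?S n" by (rule integral_nonneg_AE) simp
      then have "\<bar>\<rho> n\<bar> = \<bar>C * (LINT x|M. H n x)\<bar> * ?S n" by (simp add: \<rho>_def abs_mult)
      also have "\<dots> \<le> \<epsilon> * ?S n" using N[OF that] \<open>0 \<le> ?S n\<close> by (intro mult_right_mono) auto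
      finally show ?thesis by (simp add: V_norm_err)
    qed
    then show "\<exists>N. \<forall>n\<ge>N. \<bar>\<rho> n\<bar> \<le> \<epsilon> * (V_norm \<Omega> (\<lambda>x. ustar x - u n x))\<^sup>2" by blast
  next
    fix n
    define K where "K = k n"
    have K: "0 < K" "K \<le> 1" using k01 by (auto simp: K_def)
    let ?D2 = "\<lambda>x. weight n x * (norm (step n x))\<^sup>2" and ?Dd = "\<lambda>x. weight n x * (step n x \<bullet> err n x)"
      and ?B = "\<lambda>x. bregman (strn (u n) x) (strn ustar x)"
    have i: "integrable M ?D2" "integrable M ?Dd" "integrable M ?B"
      by (intro integrable_weight_square integrable_weight_inner integrable_bregman step_L2 err_L2 ustar_W)+
    have "(E (u (Suc n)) - E (u n)) + K / 4 * (E (u n) - E ustar)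
        \<le> - (1/2) * (LINT x|M. ?D2 x) + K / 4 * ((LINT x|M. ?Dd x) - (LINT x|M. ?B x))"
    proof -
      have "E (u n) - E ustar = (LINT x|M. ?Dd x) - (LINT x|M. ?B x)" using gap[of n] by simp
      then show ?thesis using descent[of n] by simp
    qed
    also have "\<dots> = (LINT x|M. - (1/2) * ?D2 x + K / 4 * (?Dd x - ?B x))"
      using i by simp
    also have "\<dots> \<le> (LINT x|M. C * ?S n * H n x)"
    proof (rule integral_mono_AE)
      show "integrable M (\<lambda>x. - (1/2) * ?D2 x + K / 4 * (?Dd x - ?B x))" using i by simp
      show "integrable M (\<lambda>x. C * ?S n * H n x)" using iH by simp
      show "AE x in M. - (1/2) * ?D2 x + K / 4 * (?Dd x - ?B x) \<le> C * ?S n * H n x"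
        using bound[of n]
      proof eventually_elim
        case (elim x)
        let ?w = "weight n x" and ?d = "(norm (err n x))\<^sup>2"
        have w: "0 < ?w" "?w \<le> C" using weight_bounds by (auto simp: C_def)
        \<comment> \<open>Completing the square: the left side of \<open>young\<close>, quadratic in
          the step, is largest when the step is \<open>K / 4\<close> times the error.\<close>
        have "0 \<le> ?w / 2 * (norm (step n x - (K / 4) *\<^sub>R err n x))\<^sup>2" using w by simp
        also have "(norm (step n x - (K / 4) *\<^sub>R err n x))\<^sup>2
            = (norm (step n x))\<^sup>2 - K / 2 * (step n x \<bullet> err n x) + K\<^sup>2 / 16 * ?d"
          unfolding norm_diff_scaleR_square by (simp add: power_divide)
        finally have young: "- (1/2) * ?D2 x + K / 4 * ?Dd x \<le> K\<^sup>2 / 32 * (?w * ?d)"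
          by (simp add: algebra_simps)
        show ?case
        proof (cases "bad n x")
          case False
          then have "K / 8 * (?w * ?d) \<le> ?B x" by (simp add: bad_def K_def mult.assoc)
          \<comment> \<open>The constant 1/8 in the definition of \<open>bad\<close> is the one for
            which this term cancels the \<open>K\<^sup>2 / 32\<close> left by the square, so good
            points contribute nothing.\<close>
          then have "K / 4 * (K / 8 * (?w * ?d)) \<le> K / 4 * ?B x" using K by (intro mult_left_mono) auto
          then have "- (1/2) * ?D2 x + K / 4 * (?Dd x - ?B x) \<le> 0"
            using young by (simp add: algebra_simps power2_eq_square)
          then show ?thesis using False by (simp add: H_def)
        next
          case True
          \<comment> \<open>At a bad point the Bregman term is only known to be nonnegative, and the
            leftover of the square is bounded through \<open>G\<close>.\<close>
          have "0 \<le> K / 4 * ?B x" using K by (intro mult_nonneg_nonneg bregman_nonneg) simp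
          moreover have "K\<^sup>2 / 32 * (?w * ?d) \<le> 1 * (?w * ?d)"
            using w K power_le_one[of K 2] by (intro mult_right_mono) auto
          moreover have "?w * ?d \<le> C * (?S n * G x)"
            using w elim by (intro mult_mono) auto
          ultimately have "- (1/2) * ?D2 x + K / 4 * (?Dd x - ?B x) \<le> C * (?S n * G x)"
            using young by (simp add: right_diff_distrib)
          then show ?thesis using True by (simp add: H_def mult.assoc)
        qed
      qed
    qed
    also have "\<dots> = \<rho> n" by (simp add: \<rho>_def)
    finally show "E (u (Suc n)) - E ustar \<le> (1 - (1/4) * k n) * (E (u n) - E ustar) + \<rho> n"
      by (simp add: K_def algebra_simps)
  qed
qed

end

section \<open>The contraction estimate with the two possible values of \<open>q_A\<close>\<close>

theorem mainTheorem3: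
  fixes \<Omega> :: "(real^'d::finite) set"
    and f ustar :: "real^'d \<Rightarrow> real^'d"
    and W :: "(real^'d \<Rightarrow> real^'d) set"
    and u :: "nat \<Rightarrow> real^'d \<Rightarrow> real^'d"
    and r em ep :: real
  assumes dim: "CARD('d) = 2 \<or> CARD('d) = 3"
    and domain: "bounded_lipschitz_domain \<Omega>"
    and force: "f \<in> L2 \<Omega>"
    and r: "1 < r" "r < 2"
    and eps: "0 < em" "em < ep"
    and W: "fin_dim_subspace_V \<Omega> W"
    and minimiser: "is_arg_min (energy \<Omega> f r em ep) (\<lambda>v. v \<in> W) ustar"
    and iteration: "kacanov_sequence \<Omega> f r em ep W u"
    and null: "\<And>n. {x \<in> \<Omega>. norm (strain \<Omega> (u n) x) \<in> {em, ep}} \<in> null_sets lebesgue"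
  shows "(\<exists>\<rho> :: nat \<Rightarrow> real.
            (\<forall>\<epsilon>>0. \<exists>N. \<forall>n\<ge>N. \<bar>\<rho> n\<bar> \<le> \<epsilon> * (V_norm \<Omega> (\<lambda>x. ustar x - u n x))\<^sup>2) \<and>
            (\<forall>n. 0 \<le> energy \<Omega> f r em ep (u (Suc n)) - energy \<Omega> f r em ep ustar \<and>
                 energy \<Omega> f r em ep (u (Suc n)) - energy \<Omega> f r em ep ustar
                   \<le> q_A \<Omega> r em ep (u n) *
                        (energy \<Omega> f r em ep (u n) - energy \<Omega> f r em ep ustar) + \<rho> n)) \<and>
         (\<forall>n. q_A \<Omega> r em ep (u n) \<le> 1 - (1/4) * (r - 1)) \<and>
         (\<forall>n. emeasure lebesgue {x \<in> \<Omega>. em \<le> norm (strain \<Omega> (u n) x) \<and>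
                                         norm (strain \<Omega> (u n) x) \<le> ep} > 0
            \<longrightarrow> q_A \<Omega> r em ep (u n) = 1 - (1/4) * (r - 1))"
proof -
  have \<Omega>: "open \<Omega>" "bounded \<Omega>" "\<Omega> \<noteq> {}"
    using domain by (auto simp: bounded_lipschitz_domain_def)
  interpret kacanov r em ep \<Omega> f W u ustar
    using r eps \<Omega> force W minimiser iteration by unfold_locales
  \<comment> \<open>The reciprocal of the essential supremum as decided by
    \<open>q_A_dichotomy\<close>, so that \<open>q_A\<close> is exactly the factor in
    \<open>energy_contraction\<close>.\<close>
  define k where "k n = (if emeasure lebesgue {x \<in> \<Omega>. em \<le> norm (strain \<Omega> (u n) x) \<and>
      norm (strain \<Omega> (u n) x) \<le> ep} > 0 then r - 1 else 1)" for n
  note dichotomy = q_A_dichotomy[OF \<Omega>(1,3) strn_L2[OF u_W] null]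
  have q: "q_A \<Omega> r em ep (u n) = 1 - (1/4) * k n" for n
    using dichotomy[of n] by (auto simp: k_def)
  have k: "k n = r - 1 \<or> k n = 1 \<and> (AE x in lebesgue_on \<Omega>. norm (strain \<Omega> (u n) x) \<notin> {em..ep})" for n
    using dichotomy(2)[of n] by (auto simp: k_def)
  obtain \<rho> where
    "\<And>\<epsilon>. 0 < \<epsilon> \<Longrightarrow> \<exists>N. \<forall>n\<ge>N. \<bar>\<rho> n\<bar> \<le> \<epsilon> * (V_norm \<Omega> (\<lambda>x. ustar x - u n x))\<^sup>2"
    "\<And>n. E (u (Suc n)) - E ustar \<le> (1 - (1/4) * k n) * (E (u n) - E ustar) + \<rho> n"
    using energy_contraction[OF k] by blast
  moreover have "E ustar \<le> E (u (Suc n))" for n by (intro E_ge u_W)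
  moreover have "q_A \<Omega> r em ep (u n) \<le> 1 - (1/4) * (r - 1)" for n
    unfolding q using r by (simp add: k_def)
  ultimately show ?thesis
    using dichotomy(1) unfolding q by (intro conjI exI[of _ \<rho>]) auto
qed

end
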